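(* Let $I_0=u_{00}$ and let $I_{i,j}$ be the coefficients of the tensors $\Theta_k$ with respect to the coframe $\omega_1=\widehat{d}u_{00}$, $\omega_2=\widehat{d}I_2$, $$\Theta_k=\sum_{i=0}^k I_{i,k-i}\frac{\omega_1^i}{i!}\frac{\omega_2^{k-i}}{(k-i)!},\qquad k=0,1,2,\dots$$ Then rational affine differential invariants of algebraic plane curves are rational functions of the invariants $I_{i,j}I_0^{\,i+j-1}$.
   Context: $\mathbf{J}^k$ is the space of $k$-jets of functions on the plane $\mathbb{R}^2$ with canonical coordinates $x,y,u_{ij}$ ($0\le i+j\le k$), where $u_{ij}([f]^k_p)=\frac{\partial^{i+j}f}{\partial x^i\partial y^j}(p)$. The affine Lie algebra $\mathfrak{aff}_2=\langle\partial_x,\partial_y,x\partial_x,x\partial_y,y\partial_x,y\partial_y\rangle$ acts on the plane, and its vector fields are prolonged to $\mathbf{J}^k$ (the action on functions is by change of the independent variables, so $u_{00}$ is invariant). A rational affine differential invariant of order $\le k$ is a rational function of the canonical coordinates of $\mathbf{J}^k$ annihilated by the $k$-th prolongations of all vector fields in $\mathfrak{aff}_2$. An algebraic plane curve is given by $P(x,y)=0$ with $P$ an irreducible polynomial defined up to a nonzero multiplier $P\mapsto\lambda P$. This scaling is generated on jets by $\gamma=\sum_{i,j}u_{ij}\frac{\partial}{\partial u_{ij}}$. An invariant $I$ has weight $w(I)$ if $\gamma(I)=w(I)I$. Rational affine differential invariants of algebraic plane curves are by definition the rational affine differential invariants of weight zero, i.e. those with $\gamma(I)=0$. $\widehat{d}f=\frac{df}{dx}dx+\frac{df}{dy}dy$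 is the total differential, where $\frac{d}{dx},\frac{d}{dy}$ are total derivatives. $$I_2=\frac{u_{01}^2u_{20}-2u_{10}u_{01}u_{11}+u_{10}^2u_{02}}{u_{20}u_{02}-u_{11}^2}.$$ Symmetric tensors: $\Theta_k=\sum_{i=0}^k u_{i,k-i}\frac{dx^i}{i!}\frac{dy^{k-i}}{(k-i)!}$, where $dx,dy$ are expressed through $\omega_1,\omega_2$ by inverting $\omega_1=u_{10}dx+u_{01}dy$, $\omega_2=\frac{dI_2}{dx}dx+\frac{dI_2}{dy}dy$. In particular $I_{0,0}=u_{00}$. *)

theory Defs
  imports
    Complex_Main
    "HOL-Library.Nat_Bijection"
    "HOL-Library.Poly_Mapping"
    "HOL-Computational_Algebra.Fraction_Field"
    "HOL-Computational_Algebra.Polynomial"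
begin

text \<open>
  \<open>U i j\<close> is the jet coordinate of the derivative \<open>i\<close> times in \<open>x\<close> and \<open>j\<close> times in \<open>y\<close>.
\<close>

datatype coord = X | Y | U nat nat

text \<open>
  The order on coordinates has no meaning; \<^theory>\<open>HOL-Library.Poly_Mapping\<close> needs some linear
  order on the variables to provide the instance of \<^class>\<open>idom\<close> for polynomials.
\<close>

fun coord_code :: "coord \<Rightarrow> nat" where
  "coord_code X = 0"
| "coord_code Y = 1"
| "coord_code (U i j) = 2 + prod_encode (i, j)"

lemma coord_code_inject: "coord_code v = coord_code w \<longleftrightarrow> v = w"
  by (cases v; cases w) auto

instantiation coord :: linorder
begin

definition "v \<le> w \<longleftrightarrow> coord_code v \<le> coord_code w"

definition "v < w \<longleftrightarrow> coord_code v < coord_code w"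

instance
  by standard (auto simp: less_eq_coord_def less_coord_def coord_code_inject)

end

type_synonym jet_poly = "(coord \<Rightarrow>\<^sub>0 nat) \<Rightarrow>\<^sub>0 real"

text \<open>Rational functions in the coordinates of the jets of all (finite) orders.\<close>

type_synonym jet_rat = "jet_poly fract"

definition cst :: "real \<Rightarrow> jet_rat" where
  "cst c = Fraction_Field.Fract (Poly_Mapping.single 0 c) 1"

definition var :: "coord \<Rightarrow> jet_rat" where
  "var v = Fraction_Field.Fract (Poly_Mapping.single (Poly_Mapping.single v 1) 1) 1"

abbreviation u :: "nat \<Rightarrow> nat \<Rightarrow> jet_rat" where
  "u i j \<equiv> var (U i j)"

text \<open>The field extension of the reals generated by \<open>S\<close> inside the field of rational functions.\<close>

inductive_set rat_gen :: "jet_rat set \<Rightarrow> jet_rat set" for S :: "jet_rat set" where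
  cst: "cst c \<in> rat_gen S"
| gen: "f \<in> S \<Longrightarrow> f \<in> rat_gen S"
| add: "f \<in> rat_gen S \<Longrightarrow> g \<in> rat_gen S \<Longrightarrow> f + g \<in> rat_gen S"
| mult: "f \<in> rat_gen S \<Longrightarrow> g \<in> rat_gen S \<Longrightarrow> f * g \<in> rat_gen S"
| divide: "f \<in> rat_gen S \<Longrightarrow> g \<in> rat_gen S \<Longrightarrow> g \<noteq> 0 \<Longrightarrow> f / g \<in> rat_gen S"

definition jet_rats :: "nat \<Rightarrow> jet_rat set" where
  "jet_rats k = rat_gen (var ` ({X, Y} \<union> {U i j | i j. i + j \<le> k}))"


subsection \<open>Partial and total derivatives\<close>

definition poly_pd :: "coord \<Rightarrow> jet_poly \<Rightarrow> jet_poly" where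
  "poly_pd v p = (\<Sum>m\<in>Poly_Mapping.keys p. Poly_Mapping.single (m - Poly_Mapping.single v 1)
      (real (Poly_Mapping.lookup m v) * Poly_Mapping.lookup p m))"

lemma poly_pd_superset:
  assumes "finite M" "Poly_Mapping.keys p \<subseteq> M"
  shows "poly_pd v p = (\<Sum>m\<in>M. Poly_Mapping.single (m - Poly_Mapping.single v 1)
      (real (Poly_Mapping.lookup m v) * Poly_Mapping.lookup p m))"
  unfolding poly_pd_def
  by (rule sum.mono_neutral_left) (use assms in \<open>auto simp: in_keys_iff\<close>)

lemma poly_pd_add: "poly_pd v (p + q) = poly_pd v p + poly_pd v q"
proof -
  let ?M = "Poly_Mapping.keys p \<union> Poly_Mapping.keys q"
  have "finite ?M" "Poly_Mapping.keys (p + q) \<subseteq> ?M"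
    by (simp_all add: Poly_Mapping.keys_add)
  then show ?thesis
    by (simp add: poly_pd_superset[of ?M] lookup_add distrib_left single_add sum.distrib)
qed

lemma poly_pd_zero: "poly_pd v 0 = 0"
  by (simp add: poly_pd_def)

lemma poly_pd_single: "poly_pd v (Poly_Mapping.single m c) =
    Poly_Mapping.single (m - Poly_Mapping.single v 1) (real (Poly_Mapping.lookup m v) * c)"
  by (cases "c = 0") (simp_all add: poly_pd_def)

lemma jet_poly_induct [case_names zero add]:
  assumes "P 0" and "\<And>p m c. P p \<Longrightarrow> P (p + Poly_Mapping.single m c)"
  shows "P (p :: jet_poly)"
proof (induction p rule: update_induct)
  case const
  show ?case using assms(1) by simp
next
  case (update f a b)
  from update(1) have "Poly_Mapping.update a b f = f + Poly_Mapping.single a b"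
    by (intro poly_mapping_eqI)
      (auto simp: lookup_add lookup_update lookup_single in_keys_iff when_def)
  then show ?case using assms(2)[OF update(3)] by (simp only:)
qed

lemma poly_pd_mult_single: "poly_pd v (Poly_Mapping.single m c * Poly_Mapping.single n d) =
    poly_pd v (Poly_Mapping.single m c) * Poly_Mapping.single n d +
    Poly_Mapping.single m c * poly_pd v (Poly_Mapping.single n d)"
proof -
  let ?e = "Poly_Mapping.single v (1::nat)"
  have 1: "m + n - ?e = (m - ?e) + n" if "Poly_Mapping.lookup m v \<noteq> 0"
    using that by (intro poly_mapping_eqI) (auto simp: lookup_add lookup_minus lookup_single when_def)
  have 2: "m + n - ?e = m + (n - ?e)" if "Poly_Mapping.lookup n v \<noteq> 0"
    using that by (intro poly_mapping_eqI) (auto simp: lookup_add lookup_minus lookup_single when_def)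
  have 3: "Poly_Mapping.single (m + n - ?e) (real (Poly_Mapping.lookup m v) * (c * d)) =
      Poly_Mapping.single (m - ?e + n) (real (Poly_Mapping.lookup m v) * (c * d))"
    by (cases "Poly_Mapping.lookup m v = 0") (simp_all add: 1[simplified])
  have 4: "Poly_Mapping.single (m + n - ?e) (real (Poly_Mapping.lookup n v) * (c * d)) =
      Poly_Mapping.single (m + (n - ?e)) (real (Poly_Mapping.lookup n v) * (c * d))"
    by (cases "Poly_Mapping.lookup n v = 0") (simp_all add: 2[simplified])
  have "poly_pd v (Poly_Mapping.single m c * Poly_Mapping.single n d) =
      Poly_Mapping.single (m + n - ?e) (real (Poly_Mapping.lookup m v) * (c * d)) +
      Poly_Mapping.single (m + n - ?e) (real (Poly_Mapping.lookup n v) * (c * d))"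
    by (simp add: poly_pd_single mult_single lookup_add distrib_right single_add)
  then show ?thesis
    unfolding 3 4 by (simp add: poly_pd_single mult_single mult.assoc mult.left_commute)
qed

lemma poly_pd_mult: "poly_pd v (p * q) = poly_pd v p * q + p * poly_pd v q"
proof (induction p rule: jet_poly_induct)
  case (add p m c)
  have "poly_pd v (Poly_Mapping.single m c * q) =
      poly_pd v (Poly_Mapping.single m c) * q + Poly_Mapping.single m c * poly_pd v q"
    by (induction q rule: jet_poly_induct)
      (simp_all add: poly_pd_zero poly_pd_add distrib_left poly_pd_mult_single ac_simps)
  with add show ?case by (simp add: poly_pd_add algebra_simps)
qed (simp add: poly_pd_zero)

lift_definition pd :: "coord \<Rightarrow> jet_rat \<Rightarrow> jet_rat" is
  "\<lambda>v (p, q). (poly_pd v p * q - p * poly_pd v q, q * q)"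
proof -
  fix v and r s :: "jet_poly \<times> jet_poly"
  obtain a b c d where rs: "r = (a, b)" "s = (c, d)" by (cases r; cases s)
  assume "fractrel r s"
  then have nz: "b \<noteq> 0" "d \<noteq> 0" and eq: "a * d = c * b" by (auto simp: rs fractrel_def)
  have eq': "poly_pd v a * d + a * poly_pd v d = poly_pd v c * b + c * poly_pd v b"
    using arg_cong[OF eq, of "poly_pd v"] by (simp add: poly_pd_mult)
  have "(poly_pd v a * b - a * poly_pd v b) * (d * d) =
      b * d * (poly_pd v a * d + a * poly_pd v d) - a * d * (b * poly_pd v d + d * poly_pd v b)"
    by algebra
  also have "\<dots> = b * d * (poly_pd v c * b + c * poly_pd v b)
      - c * b * (b * poly_pd v d + d * poly_pd v b)"
    by (simp only: eq eq')
  also have "\<dots> = (poly_pd v c * d - c * poly_pd v d) * (b * b)"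
    by algebra
  finally show "fractrel (case r of (p, q) \<Rightarrow> (poly_pd v p * q - p * poly_pd v q, q * q))
      (case s of (p, q) \<Rightarrow> (poly_pd v p * q - p * poly_pd v q, q * q))"
    using nz by (simp add: rs fractrel_def)
qed

text \<open>
  Every rational function involves finitely many coordinates only, hence the sums are finite.
\<close>

definition Dx :: "jet_rat \<Rightarrow> jet_rat" where
  "Dx f = pd X f + (\<Sum>(i, j) | pd (U i j) f \<noteq> 0. u (i + 1) j * pd (U i j) f)"

definition Dy :: "jet_rat \<Rightarrow> jet_rat" where
  "Dy f = pd Y f + (\<Sum>(i, j) | pd (U i j) f \<noteq> 0. u i (j + 1) * pd (U i j) f)"


subsection \<open>Affine differential invariants\<close>

text \<open>
  A vector field \<open>a \<partial>\<^sub>x + b \<partial>\<^sub>y\<close> on the plane is given by the pair of its coefficients. Acting on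
  functions by change of the independent variables, it has the characteristic
  \<open>Q = - a u\<^sub>1\<^sub>0 - b u\<^sub>0\<^sub>1\<close>, and the \<open>\<partial>/\<partial>u\<^sub>i\<^sub>j\<close>-component of its prolongation is
  \<open>D\<^sub>x\<^sup>i D\<^sub>y\<^sup>j Q + a u\<^sub>i\<^sub>+\<^sub>1\<^sub>,\<^sub>j + b u\<^sub>i\<^sub>,\<^sub>j\<^sub>+\<^sub>1\<close> (where the terms of order \<open>i + j + 1\<close> cancel).
\<close>

definition prolong_coeff :: "jet_rat \<times> jet_rat \<Rightarrow> nat \<Rightarrow> nat \<Rightarrow> jet_rat" where
  "prolong_coeff = (\<lambda>(a, b) i j.
     (Dx ^^ i) ((Dy ^^ j) (- a * u 1 0 - b * u 0 1)) + a * u (i + 1) j + b * u i (j + 1))"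

definition prolong :: "nat \<Rightarrow> jet_rat \<times> jet_rat \<Rightarrow> jet_rat \<Rightarrow> jet_rat" where
  "prolong k = (\<lambda>(a, b) f. a * pd X f + b * pd Y f +
     (\<Sum>(i, j) | i + j \<le> k. prolong_coeff (a, b) i j * pd (U i j) f))"

definition aff2 :: "(jet_rat \<times> jet_rat) set" where
  "aff2 = {(cst a0 + cst a1 * var X + cst a2 * var Y, cst b0 + cst b1 * var X + cst b2 * var Y)
           | a0 a1 a2 b0 b1 b2. True}"

definition affine_invariants :: "nat \<Rightarrow> jet_rat set" where
  "affine_invariants k = {f \<in> jet_rats k. \<forall>V \<in> aff2. prolong k V f = 0}"

definition scaling_field :: "nat \<Rightarrow> jet_rat \<Rightarrow> jet_rat" where
  "scaling_field k f = (\<Sum>(i, j) | i + j \<le> k. u i j * pd (U i j) f)"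

text \<open>
  Invariants of algebraic curves \<open>P = 0\<close> are, by definition, the affine invariants of weight zero
  with respect to the scaling of \<open>P\<close>.
\<close>

definition curve_invariants :: "nat \<Rightarrow> jet_rat set" where
  "curve_invariants k = {f \<in> affine_invariants k. scaling_field k f = 0}"


subsection \<open>The invariant coframe and the symmetric tensors\<close>

definition I2 :: jet_rat where
  "I2 = ((u 0 1)\<^sup>2 * u 2 0 - 2 * u 1 0 * u 0 1 * u 1 1 + (u 1 0)\<^sup>2 * u 0 2)
        / (u 2 0 * u 0 2 - (u 1 1)\<^sup>2)"

text \<open>
  Symmetric tensors in \<open>dx, dy\<close> are polynomials in the two variables \<open>dx, dy\<close> over the rational
  functions, the symmetric product being the product of polynomials.
\<close>

type_synonym sym_tensor = "jet_rat poly poly"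

definition scal :: "jet_rat \<Rightarrow> sym_tensor" where
  "scal f = [:[:f:]:]"

definition dx :: sym_tensor where
  "dx = [:[:0, 1:]:]"

definition dy :: sym_tensor where
  "dy = [:0, 1:]"

definition total_diff :: "jet_rat \<Rightarrow> sym_tensor" where
  "total_diff f = scal (Dx f) * dx + scal (Dy f) * dy"

definition \<omega>1 :: sym_tensor where
  "\<omega>1 = total_diff (u 0 0)"

definition \<omega>2 :: sym_tensor where
  "\<omega>2 = total_diff I2"

definition \<Theta> :: "nat \<Rightarrow> sym_tensor" where
  "\<Theta> k = (\<Sum>i\<le>k. scal (cst (1 / (fact i * fact (k - i))) * u i (k - i)) * dx ^ i * dy ^ (k - i))"

text \<open>
  \<open>I\<close> is determined by this condition, since \<open>\<omega>1\<close> and \<open>\<omega>2\<close> are linearly independent;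
  for the existence see \<open>coframe_coeffs_exists\<close> below.
\<close>

definition coframe_coeffs :: "(nat \<Rightarrow> nat \<Rightarrow> jet_rat) \<Rightarrow> bool" where
  "coframe_coeffs I \<longleftrightarrow> (\<forall>k. \<Theta> k =
     (\<Sum>i\<le>k. scal (cst (1 / (fact i * fact (k - i))) * I i (k - i)) * \<omega>1 ^ i * \<omega>2 ^ (k - i)))"


subsection \<open>Existence of the coefficients\<close>

lemma poly_pd_uminus: "poly_pd v (- p) = - poly_pd v p"
  using poly_pd_add[of v p "- p"] by (simp add: poly_pd_zero eq_neg_iff_add_eq_0 add.commute)

lemma pd_Fract: "q \<noteq> 0 \<Longrightarrow> pd v (Fraction_Field.Fract p q) =
    Fraction_Field.Fract (poly_pd v p * q - p * poly_pd v q) (q * q)"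
  by (simp add: Fraction_Field.Fract.abs_eq pd.abs_eq fractrel_def)

lemma poly_pd_1: "poly_pd v 1 = 0"
  using poly_pd_single[of v 0 1] by (simp only: single_one lookup_zero of_nat_0 mult_zero_left single_zero)

lemma pd_cst [simp]: "pd v (cst c) = 0"
  by (simp add: cst_def pd_Fract poly_pd_single poly_pd_1 fract_collapse)

lemma pd_var: "pd v (var w) = (if v = w then 1 else 0)"
  by (auto simp: var_def pd_Fract poly_pd_single poly_pd_1 fract_collapse lookup_single when_def)

lemma pd_add: "pd v (f + g) = pd v f + pd v g"
proof (cases f, cases g)
  fix a b c d assume [simp]: "f = Fraction_Field.Fract a b" "b \<noteq> 0" "g = Fraction_Field.Fract c d" "d \<noteq> 0"
  show ?thesis
    by (simp add: pd_Fract eq_fract poly_pd_add poly_pd_mult) algebra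
qed

lemma pd_mult: "pd v (f * g) = pd v f * g + f * pd v g"
proof (cases f, cases g)
  fix a b c d assume [simp]: "f = Fraction_Field.Fract a b" "b \<noteq> 0" "g = Fraction_Field.Fract c d" "d \<noteq> 0"
  show ?thesis
    by (simp add: pd_Fract eq_fract poly_pd_add poly_pd_mult) algebra
qed

lemma pd_0 [simp]: "pd v 0 = 0" using pd_add[of v 0 0] by (metis add_cancel_right_right add_0)

lemma pd_1 [simp]: "pd v 1 = 0"
  using pd_mult[of v 1 1] by (metis add_cancel_right_right mult_1 mult_1_right)

lemma pd_uminus: "pd v (- f) = - pd v f"
  using pd_add[of v f "- f"] by (simp add: eq_neg_iff_add_eq_0 add.commute)

lemma pd_diff: "pd v (f - g) = pd v f - pd v g"
  using pd_add[of v f "- g"] by (simp add: pd_uminus)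

lemma pd_numeral [simp]: "pd v (numeral n) = 0"
proof -
  have "pd v (of_nat k) = 0" for k by (induction k) (simp_all add: pd_add)
  from this[of "numeral n"] show ?thesis by simp
qed

lemma finite_poly_pd: "finite {v. poly_pd v p \<noteq> 0}"
proof (induction p rule: jet_poly_induct)
  case (add p m c)
  have "finite {v. poly_pd v (Poly_Mapping.single m c) \<noteq> 0}"
    by (rule finite_subset[of _ "Poly_Mapping.keys m"]) (auto simp: poly_pd_single in_keys_iff intro!: gr0I)
  with add have "finite ({v. poly_pd v p \<noteq> 0} \<union> {v. poly_pd v (Poly_Mapping.single m c) \<noteq> 0})"
    by simp
  then show ?case by (rule rev_finite_subset) (auto simp: poly_pd_add)
qed (simp add: poly_pd_zero)

lemma finite_pd: "finite {(i, j). pd (U i j) f \<noteq> 0}"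
proof (cases f)
  case (Fract a b)
  have "finite ({v. poly_pd v a \<noteq> 0} \<union> {v. poly_pd v b \<noteq> 0})" by (simp add: finite_poly_pd)
  then have "finite {v. pd v f \<noteq> 0}"
    by (rule rev_finite_subset) (auto simp: Fract pd_Fract fract_collapse)
  then have "finite ((\<lambda>(i, j). U i j) -` {v. pd v f \<noteq> 0})"
    by (rule finite_vimageI) (auto simp: inj_def)
  then show ?thesis by (rule rev_finite_subset) auto
qed

definition tot_D :: "bool \<Rightarrow> jet_rat \<Rightarrow> jet_rat" where "tot_D b = (if b then Dx else Dy)"

definition shift :: "bool \<Rightarrow> nat \<times> nat \<Rightarrow> jet_rat" where
 "shift b = (\<lambda>(i,j). if b then u (i+1) j else u i (j+1))"

definition base :: "bool \<Rightarrow> coord" where "base b = (if b then X else Y)"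

lemma tot_D_eq: assumes "finite M" "{(i, j). pd (U i j) f \<noteq> 0} \<subseteq> M"
  shows "tot_D b f = pd (base b) f + (\<Sum>z\<in>M. shift b z * pd (U (fst z) (snd z)) f)"
proof -
  have "tot_D b f = pd (base b) f + (\<Sum>z\<in>{(i, j). pd (U i j) f \<noteq> 0}. shift b z * pd (U (fst z) (snd z)) f)"
    by (auto simp: tot_D_def shift_def base_def Dx_def Dy_def case_prod_unfold)
  also have "(\<Sum>z\<in>{(i, j). pd (U i j) f \<noteq> 0}. shift b z * pd (U (fst z) (snd z)) f)
    = (\<Sum>z\<in>M. shift b z * pd (U (fst z) (snd z)) f)"
    by (rule sum.mono_neutral_left) (use assms in auto)
  finally show ?thesis .
qed

lemma tot_D_mult: "tot_D b (f * g) = tot_D b f * g + f * tot_D b g"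
proof -
  let ?M = "{(i, j). pd (U i j) f \<noteq> 0} \<union> {(i, j). pd (U i j) g \<noteq> 0}"
  have f: "finite ?M" using finite_pd[of f] finite_pd[of g] by (rule finite_UnI)
  have "{(i, j). pd (U i j) (f*g) \<noteq> 0} \<subseteq> ?M" by (auto simp: pd_mult)
  then have 1: "tot_D b (f*g) = pd (base b) (f*g) + (\<Sum>z\<in>?M. shift b z * pd (U (fst z) (snd z)) (f*g))"
    using tot_D_eq f by blast
  have 2: "tot_D b f = pd (base b) f + (\<Sum>z\<in>?M. shift b z * pd (U (fst z) (snd z)) f)"
    using tot_D_eq[OF f] by blast
  have 3: "tot_D b g = pd (base b) g + (\<Sum>z\<in>?M. shift b z * pd (U (fst z) (snd z)) g)"
    using tot_D_eq[OF f] by blast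
  show ?thesis unfolding 1 2 3
    by (simp add: pd_mult algebra_simps sum.distrib sum_distrib_left)
qed

lemma tot_D_add: "tot_D b (f + g) = tot_D b f + tot_D b g"
proof -
  let ?M = "{(i, j). pd (U i j) f \<noteq> 0} \<union> {(i, j). pd (U i j) g \<noteq> 0}"
  have f: "finite ?M" using finite_pd[of f] finite_pd[of g] by (rule finite_UnI)
  have "{(i, j). pd (U i j) (f+g) \<noteq> 0} \<subseteq> ?M" by (auto simp: pd_add)
  then have 1: "tot_D b (f+g) = pd (base b) (f+g) + (\<Sum>z\<in>?M. shift b z * pd (U (fst z) (snd z)) (f+g))"
    using tot_D_eq f by blast
  have 2: "tot_D b f = pd (base b) f + (\<Sum>z\<in>?M. shift b z * pd (U (fst z) (snd z)) f)"
    using tot_D_eq[OF f] by blast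
  have 3: "tot_D b g = pd (base b) g + (\<Sum>z\<in>?M. shift b z * pd (U (fst z) (snd z)) g)"
    using tot_D_eq[OF f] by blast
  show ?thesis unfolding 1 2 3
    by (simp add: pd_add algebra_simps sum.distrib)
qed

lemma tot_D_1: "tot_D b 1 = 0" using tot_D_mult[of b 1 1] by (metis add_cancel_right_right mult_1 mult_1_right)

lemma tot_D_0: "tot_D b 0 = 0" using tot_D_add[of b 0 0] by (metis add_cancel_right_right add_0)

lemma tot_D_uminus: "tot_D b (-f) = - tot_D b f" using tot_D_add[of b f "-f"] by (simp add: tot_D_0 eq_neg_iff_add_eq_0 add.commute)

lemma tot_D_diff: "tot_D b (f - g) = tot_D b f - tot_D b g" using tot_D_add[of b f "-g"] by (simp add: tot_D_uminus)

lemma tot_D_numeral: "tot_D b (numeral n) = 0"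
proof -
  have "tot_D b (of_nat k) = 0" for k by (induction k) (simp_all add: tot_D_add tot_D_0 tot_D_1)
  from this[of "numeral n"] show ?thesis by simp
qed

lemma tot_D_var: "tot_D b (u i j) = shift b (i,j)"
proof -
  have "{(i', j'). pd (U i' j') (u i j) \<noteq> 0} \<subseteq> {(i,j)}" by (auto simp: pd_var split: if_splits)
  from tot_D_eq[OF _ this] show ?thesis by (simp add: pd_var base_def)
qed

lemma Dx_Dy_base: "Dx (var X) = 1" "Dy (var X) = 0" "Dx (var Y) = 0" "Dy (var Y) = 1"
  by (simp_all add: Dx_def Dy_def pd_var)

lemma Dx_Dy_eq: "Dx = tot_D True" "Dy = tot_D False" by (simp_all add: tot_D_def)

lemma var_nonzero: "var v \<noteq> 0"
proof
  assume "var v = 0"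
  then have "pd v (var v) = 0" by simp
  then show False by (simp add: pd_var)
qed

abbreviation "I2_num \<equiv> (u 0 1)\<^sup>2 * u 2 0 - 2 * u 1 0 * u 0 1 * u 1 1 + (u 1 0)\<^sup>2 * u 0 2"

abbreviation "I2_den \<equiv> u 2 0 * u 0 2 - (u 1 1)\<^sup>2"

lemma frame_aux1: "(a::'a::comm_ring_1)*h + i*k = n \<Longrightarrow> i*h = N \<Longrightarrow> a*h*h = n*h - N*k"
  by (auto simp: algebra_simps)

lemma frame_aux2: "(p*b - q*a)*h*h = p*(b*h*h) - q*(a*h*h)" for p :: "'a::comm_ring_1"
  by (simp add: algebra_simps)

lemma frame_aux3: "p * (p^2 * (c*e - f^2) - (q^2 * c - 2 * p * q * f + p^2*e) * c) = 0 \<Longrightarrow> p * (p*f - q*c)^2 = 0" for p :: "'a::idom"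
  by (simp add: algebra_simps power2_eq_square)

lemma frame_aux4: "(p*b - q*a)*x = b*(p*x+q*y) - q*(a*x+b*y)" "(p*b - q*a)*y = p*(a*x+b*y) - a*(p*x+q*y)" for p :: "'a::comm_ring_1"
  by (simp_all add: algebra_simps)

lemma I2_den_nonzero: "I2_den \<noteq> 0"
proof
  assume "I2_den = 0"
  then have "pd (U 2 0) I2_den = 0" by simp
  then show False by (simp add: pd_var pd_diff pd_add pd_mult power2_eq_square var_nonzero)
qed

lemma coframe_det_nonzero: "u 1 0 * Dy I2 - u 0 1 * Dx I2 \<noteq> 0"
proof
  assume 0: "u 1 0 * Dy I2 - u 0 1 * Dx I2 = 0"
  have e: "I2 * I2_den = I2_num" using I2_den_nonzero by (simp add: I2_def)
  have d: "tot_D b I2 * I2_den * I2_den = tot_D b I2_num * I2_den - I2_num * tot_D b I2_den" for b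
  proof -
    have "tot_D b I2 * I2_den + I2 * tot_D b I2_den = tot_D b I2_num" using arg_cong[OF e, of "tot_D b"] by (simp only: tot_D_mult)
    from frame_aux1[OF this e] show ?thesis .
  qed
  have "(u 1 0 * Dy I2 - u 0 1 * Dx I2) * I2_den * I2_den = 
     u 1 0 * (tot_D False I2_num * I2_den - I2_num * tot_D False I2_den) - u 0 1 * (tot_D True I2_num * I2_den - I2_num * tot_D True I2_den)"
    unfolding d[symmetric] Dx_Dy_eq by (rule frame_aux2)
  then have "u 1 0 * (tot_D False I2_num * I2_den - I2_num * tot_D False I2_den) - u 0 1 * (tot_D True I2_num * I2_den - I2_num * tot_D True I2_den) = 0"
    using 0 by simp
  then have "pd (U 0 3) (u 1 0 * (tot_D False I2_num * I2_den - I2_num * tot_D False I2_den) - u 0 1 * (tot_D True I2_num * I2_den - I2_num * tot_D True I2_den)) = 0"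
    by simp
  then have "u 1 0 * ((u 1 0)^2 * I2_den - I2_num * u 2 0) = 0"
    by (simp add: tot_D_var shift_def tot_D_diff tot_D_add tot_D_mult tot_D_numeral power2_eq_square pd_var pd_diff pd_add pd_mult numeral_eq_Suc)
  then have "u 1 0 * (u 1 0 * u 1 1 - u 0 1 * u 2 0)^2 = 0" by (rule frame_aux3)
  then have "u 1 0 * u 1 1 - u 0 1 * u 2 0 = 0" by (simp add: var_nonzero)
  then have "pd (U 1 1) (u 1 0 * u 1 1 - u 0 1 * u 2 0) = 0" by simp
  then show False by (simp add: pd_diff pd_mult pd_var var_nonzero)
qed

lemma scal_simps: "scal (f + g) = scal f + scal g" "scal (f * g) = scal f * scal g" "scal (f - g) = scal f - scal g" "scal 0 = 0" "scal 1 = 1"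
  by (simp_all add: scal_def one_pCons)

definition coframe_span :: "nat \<Rightarrow> sym_tensor set" where
 "coframe_span k = {t. \<exists>a. t = (\<Sum>i\<le>k. scal (a i) * \<omega>1 ^ i * \<omega>2 ^ (k - i))}"

lemma coframe_spanI: "t = (\<Sum>i\<le>k. scal (a i) * \<omega>1 ^ i * \<omega>2 ^ (k - i)) \<Longrightarrow> t \<in> coframe_span k" for a
  unfolding coframe_span_def by (rule CollectI) (rule exI)

lemma coframe_span_add: assumes "t \<in> coframe_span k" "t' \<in> coframe_span k" shows "t + t' \<in> coframe_span k"
proof -
  from assms obtain a a' where "t = (\<Sum>i\<le>k. scal (a i) * \<omega>1 ^ i * \<omega>2 ^ (k - i))"
   "t' = (\<Sum>i\<le>k. scal (a' i) * \<omega>1 ^ i * \<omega>2 ^ (k - i))" unfolding coframe_span_def by blast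
  then have "t + t' = (\<Sum>i\<le>k. scal (a i + a' i) * \<omega>1 ^ i * \<omega>2 ^ (k - i))"
    by (simp add: scal_simps algebra_simps sum.distrib)
  then show ?thesis by (rule coframe_spanI)
qed

lemma coframe_span_scal: assumes "t \<in> coframe_span k" shows "scal c * t \<in> coframe_span k"
proof -
  from assms obtain a where "t = (\<Sum>i\<le>k. scal (a i) * \<omega>1 ^ i * \<omega>2 ^ (k - i))" unfolding coframe_span_def by blast
  then have "scal c * t = (\<Sum>i\<le>k. scal (c * a i) * \<omega>1 ^ i * \<omega>2 ^ (k - i))"
    by (simp add: scal_simps sum_distrib_left mult.assoc)
  then show ?thesis by (rule coframe_spanI)
qed

lemma coframe_span_w2: assumes "t \<in> coframe_span k" shows "\<omega>2 * t \<in> coframe_span (Suc k)"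
proof -
  from assms obtain a where "t = (\<Sum>i\<le>k. scal (a i) * \<omega>1 ^ i * \<omega>2 ^ (k - i))" unfolding coframe_span_def by blast
  then have "\<omega>2 * t = (\<Sum>i\<le>Suc k. scal (if i \<le> k then a i else 0) * \<omega>1 ^ i * \<omega>2 ^ (Suc k - i))"
    by (simp add: scal_simps sum_distrib_left Suc_diff_le mult_ac)
  then show ?thesis by (rule coframe_spanI)
qed

lemma coframe_span_w1: assumes "t \<in> coframe_span k" shows "\<omega>1 * t \<in> coframe_span (Suc k)"
proof -
  from assms obtain a where "t = (\<Sum>i\<le>k. scal (a i) * \<omega>1 ^ i * \<omega>2 ^ (k - i))" unfolding coframe_span_def by blast
  then have "\<omega>1 * t = (\<Sum>i\<le>Suc k. scal (case i of 0 \<Rightarrow> 0 | Suc j \<Rightarrow> a j) * \<omega>1 ^ i * \<omega>2 ^ (Suc k - i))"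
    by (subst sum.atMost_Suc_shift) (simp add: scal_simps sum_distrib_left Suc_diff_le mult_ac)
  then show ?thesis by (rule coframe_spanI)
qed

lemma scal_inv: "c \<noteq> 0 \<Longrightarrow> scal (inverse c) * scal c = 1"
  by (simp add: scal_simps(5) flip: scal_simps(2))

lemma frame_aux5: "z * c = 1 \<Longrightarrow> c * x = r \<Longrightarrow> x = z * r" for z :: "'a::comm_ring_1"
  by (auto simp flip: mult.assoc)

lemma frame_aux6: "scal z * (scal b * S - scal q * T) = scal (z*b) * S + scal (0 - z*q) * T"
   "scal z * (scal q * T - scal b * S) = scal (0 - z*b) * S + scal (z*q) * T"
  by (simp_all only: scal_simps) (simp_all add: algebra_simps)

lemma coframe_1: "\<omega>1 = scal (u 1 0) * dx + scal (u 0 1) * dy"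
    by (simp add: \<omega>1_def total_diff_def Dx_Dy_eq tot_D_var shift_def)

lemma coframe_2: "\<omega>2 = scal (Dx I2) * dx + scal (Dy I2) * dy" by (simp only: \<omega>2_def total_diff_def)

lemma scal_D: "scal (p * b - q * a) = scal p * scal b - scal q * scal a" by (simp only: scal_simps)

lemma dxdy: "\<exists>p q. dx = scal p * \<omega>1 + scal q * \<omega>2" "\<exists>p q. dy = scal p * \<omega>1 + scal q * \<omega>2"
proof -
  note i = scal_inv[OF coframe_det_nonzero]
  have "scal (u 1 0 * Dy I2 - u 0 1 * Dx I2) * dx = scal (Dy I2) * \<omega>1 - scal (u 0 1) * \<omega>2"
    unfolding coframe_1 coframe_2 scal_D by (rule frame_aux4)
  from frame_aux5[OF i this] show "\<exists>p q. dx = scal p * \<omega>1 + scal q * \<omega>2" unfolding frame_aux6 by blast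
  have "scal (u 1 0 * Dy I2 - u 0 1 * Dx I2) * dy = scal (u 1 0) * \<omega>2 - scal (Dx I2) * \<omega>1"
    unfolding coframe_1 coframe_2 scal_D by (rule frame_aux4)
  from frame_aux5[OF i this] show "\<exists>p q. dy = scal p * \<omega>1 + scal q * \<omega>2"
    unfolding frame_aux6(1) by (subst (asm) add.commute) blast
qed

lemma coframe_span_lin: assumes "t \<in> coframe_span k" "z = scal p * \<omega>1 + scal q * \<omega>2" shows "z * t \<in> coframe_span (Suc k)"
proof -
  have "z * t = scal p * (\<omega>1 * t) + scal q * (\<omega>2 * t)" unfolding assms by (simp add: algebra_simps)
  then show ?thesis using coframe_span_add coframe_span_scal coframe_span_w1 coframe_span_w2 assms(1) by presburger
qed

lemma coframe_span_monomial: "dx ^ i * dy ^ j \<in> coframe_span (i + j)"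
proof (induction i)
  case 0
  show ?case
  proof (induction j)
    case 0
    show ?case by (rule coframe_spanI[where a = "\<lambda>_. 1"]) (simp add: scal_simps)
  next
    case (Suc j)
    obtain p q where "dy = scal p * \<omega>1 + scal q * \<omega>2" using dxdy(2) by blast
    from coframe_span_lin[OF Suc this] show ?case by simp
  qed
next
  case (Suc i)
    obtain p q where "dx = scal p * \<omega>1 + scal q * \<omega>2" using dxdy(1) by blast
    from coframe_span_lin[OF Suc this] show ?case by (simp add: mult.assoc)
qed

lemma coframe_span_sum: "finite A \<Longrightarrow> (\<And>i. i \<in> A \<Longrightarrow> f i \<in> coframe_span k) \<Longrightarrow> sum f A \<in> coframe_span k"
proof (induction A rule: finite_induct)
  case empty
  show ?case by (rule coframe_spanI[where a = "\<lambda>_. 0"]) (simp add: scal_simps)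
next
  case (insert x A) then show ?case by (simp add: coframe_span_add)
qed

lemma cst_mult: "cst (a * b) = cst a * cst b"
  by (simp add: cst_def mult_single)

lemma coframe_coeffs_exists: "\<exists>I. coframe_coeffs I"
proof -
  have "\<Theta> k \<in> coframe_span k" for k
    unfolding \<Theta>_def
  proof (rule coframe_span_sum)
    fix i assume "i \<in> {..k}"
    then show "scal (cst (1 / (fact i * fact (k - i))) * u i (k - i)) * dx ^ i * dy ^ (k - i) \<in> coframe_span k"
      using coframe_span_scal[OF coframe_span_monomial[of i "k-i"]] by (simp add: mult.assoc)
  qed simp
  then have "\<forall>k. \<exists>a. \<Theta> k = (\<Sum>i\<le>k. scal (a i) * \<omega>1 ^ i * \<omega>2 ^ (k - i))" unfolding coframe_span_def by blast
  from choice[OF this] obtain a where a: "\<And>k. \<Theta> k = (\<Sum>i\<le>k. scal (a k i) * \<omega>1 ^ i * \<omega>2 ^ (k - i))" by blast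
  have c: "cst (1 / (fact i * fact j)) * (cst (fact i * fact j) * f) = f" for i j f
  proof -
    have "cst (1 / (fact i * fact j)) * cst (fact i * fact j) = 1"
      unfolding cst_mult[symmetric] by (simp add: cst_def fract_collapse(2))
    then show ?thesis by (simp flip: mult.assoc)
  qed
  have "coframe_coeffs (\<lambda>i j. cst (fact i * fact j) * a (i+j) i)"
    unfolding coframe_coeffs_def a c by (auto intro!: sum.cong)
  then show ?thesis by (rule exI[where P = coframe_coeffs])
qed

end

theory Submission
  imports Defs
begin

text \<open>
  Let \<open>S\<close> be the set of the functions \<open>I\<^sub>i\<^sub>,\<^sub>j I\<^sub>0\<^sup>i\<^sup>+\<^sup>j\<^sup>-\<^sup>1\<close>. Expanding \<open>\<Theta>\<^sub>k\<close> in \<open>dx, dy\<close> shows that all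
  jet coordinates, and hence all rational functions, lie in the field generated over \<open>S\<close> by the seven functions
  \<open>x, y, u\<^sub>0\<^sub>0, u\<^sub>1\<^sub>0, u\<^sub>0\<^sub>1, dI\<^sub>2/dx, dI\<^sub>2/dy\<close>. The six affine vector fields and \<open>\<gamma>\<close> annihilate \<open>S\<close>,
  and their combinations over the field of rational functions take arbitrary values on these seven
  functions. So for each of the seven functions there is a combination which acts on it as the
  derivative with respect to it and annihilates \<open>S\<close>, the other six and the given invariant; in
  characteristic zero this removes the seven functions from the invariant one by one.
\<close>

text \<open>Characteristic zero makes \<open>pderiv\<close> of a nonconstant polynomial over
  \<open>jet_rat\<close> nonzero.\<close>

instance fract :: ("{idom, ring_char_0}") field_char_0
  by standard (auto intro!: injI simp: of_nat_fract eq_fract)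

subsection \<open>Generated subfields\<close>

lemma cst_add: "cst (a + b) = cst a + cst b"
  by (simp add: cst_def single_add)

lemma cst_0 [simp]: "cst 0 = 0"
  by (simp add: cst_def fract_collapse)

lemma cst_1 [simp]: "cst 1 = 1"
  by (simp add: cst_def fract_collapse)

lemma cst_eq_iff [simp]: "cst a = cst b \<longleftrightarrow> a = b"
  by (auto simp: cst_def eq_fract dest: arg_cong[where f = "\<lambda>p. Poly_Mapping.lookup p 0"])

lemma cst_of_nat: "cst (of_nat n) = of_nat n"
  by (induction n) (simp_all add: cst_add)

lemma rat_gen_0 [simp]: "0 \<in> rat_gen S" and rat_gen_1 [simp]: "1 \<in> rat_gen S"
  using rat_gen.cst[of 0 S] rat_gen.cst[of 1 S] by simp_all

lemma rat_gen_divide: "f \<in> rat_gen S \<Longrightarrow> g \<in> rat_gen S \<Longrightarrow> f / g \<in> rat_gen S"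
  by (cases "g = 0") (simp_all add: rat_gen.divide)

lemma rat_gen_power: "f \<in> rat_gen S \<Longrightarrow> f ^ n \<in> rat_gen S"
  by (induction n) (simp_all add: rat_gen.mult)

lemma rat_gen_power_int: "f \<in> rat_gen S \<Longrightarrow> f powi n \<in> rat_gen S"
  using rat_gen_divide[OF rat_gen_1] by (simp add: power_int_def rat_gen_power field_simps)

lemma rat_gen_sum: "(\<And>x. x \<in> A \<Longrightarrow> f x \<in> rat_gen S) \<Longrightarrow> sum f A \<in> rat_gen S"
  by (induction A rule: infinite_finite_induct) (simp_all add: rat_gen.add)

lemma rat_gen_least: "S \<subseteq> rat_gen T \<Longrightarrow> rat_gen S \<subseteq> rat_gen T"
proof
  fix f assume "S \<subseteq> rat_gen T" "f \<in> rat_gen S"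
  from this(2,1) show "f \<in> rat_gen T"
    by induction (auto intro: rat_gen.intros)
qed

lemma rat_gen_mono: "S \<subseteq> T \<Longrightarrow> rat_gen S \<subseteq> rat_gen T"
  by (rule rat_gen_least) (auto intro: rat_gen.gen)

lemma Fract_single_in_rat_gen:
  "Fraction_Field.Fract (Poly_Mapping.single m 1) 1 \<in> rat_gen (range var)"
proof (induction m rule: update_induct)
  case const
  show ?case by (simp add: fract_collapse)
next
  case (update m v n)
  let ?F = "\<lambda>m. Fraction_Field.Fract (Poly_Mapping.single m (1::real)) 1"
  have F_add: "?F (m + m') = ?F m * ?F m'" for m m' by (simp add: mult_single)
  have v: "?F (Poly_Mapping.single v n) = var v ^ n"
  proof (induction n)
    case (Suc n)
    have "?F (Poly_Mapping.single v (Suc n)) = ?F (Poly_Mapping.single v 1 + Poly_Mapping.single v n)"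
      by (simp flip: single_add)
    with Suc show ?case by (simp only: F_add power_Suc var_def)
  qed (simp add: fract_collapse)
  from update(1) have "Poly_Mapping.update v n m = m + Poly_Mapping.single v n"
    by (intro poly_mapping_eqI)
      (auto simp: lookup_add lookup_update lookup_single in_keys_iff when_def)
  then show ?case
    using update(3) by (auto simp only: F_add v intro!: rat_gen.mult rat_gen_power intro: rat_gen.gen)
qed

lemma Fract_poly_in_rat_gen: "Fraction_Field.Fract p 1 \<in> rat_gen (range var)"
proof (induction p rule: jet_poly_induct)
  case (add p m c)
  have "Poly_Mapping.single m c = Poly_Mapping.single 0 c * Poly_Mapping.single m 1"
    by (simp add: mult_single)
  then have "Fraction_Field.Fract (p + Poly_Mapping.single m c) 1 =
      Fraction_Field.Fract p 1 + cst c * Fraction_Field.Fract (Poly_Mapping.single m 1) 1"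
    by (simp add: cst_def)
  with add show ?case
    by (simp only:) (intro rat_gen.add rat_gen.mult rat_gen.cst Fract_single_in_rat_gen)
qed (simp add: fract_collapse)

lemma rat_gen_range_var: "f \<in> rat_gen (range var)"
proof (cases f)
  case (Fract a b)
  then have "f = Fraction_Field.Fract a 1 / Fraction_Field.Fract b 1" by simp
  then show ?thesis by (simp only:) (intro rat_gen_divide Fract_poly_in_rat_gen)
qed

lemma jet_rats_mono: "k \<le> l \<Longrightarrow> jet_rats k \<subseteq> jet_rats l"
  unfolding jet_rats_def by (intro rat_gen_mono image_mono) auto

text \<open>Only finitely many coordinates occur in a rational function; this supplies the order
  \<open>k\<close> asked for by \<open>curve_invariants\<close>.\<close>

lemma in_jet_rats: "\<exists>k. f \<in> jet_rats k"
proof -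
  have closed: "\<exists>k. h f g \<in> jet_rats k"
    if "\<exists>k. f \<in> jet_rats k" "\<exists>k. g \<in> jet_rats k"
      "\<And>k. f \<in> jet_rats k \<Longrightarrow> g \<in> jet_rats k \<Longrightarrow> h f g \<in> jet_rats k" for f g h
  proof -
    from that(1,2) obtain k l where "f \<in> jet_rats k" "g \<in> jet_rats l" by blast
    then have "f \<in> jet_rats (max k l)" "g \<in> jet_rats (max k l)"
      using jet_rats_mono[of k "max k l"] jet_rats_mono[of l "max k l"] by auto
    then show ?thesis using that(3) by blast
  qed
  from rat_gen_range_var[of f] show ?thesis
  proof induction
    case (gen f)
    then obtain v where "f = var v" by blast
    then show ?case
      by (cases v) (auto simp: jet_rats_def intro!: rat_gen.gen)
  next
    case (add f g)
    from closed[OF add(3,4)] show ?case by (auto simp: jet_rats_def intro: rat_gen.add)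
  next
    case (mult f g)
    from closed[OF mult(3,4)] show ?case by (auto simp: jet_rats_def intro: rat_gen.mult)
  next
    case (divide f g)
    from closed[OF divide(4,5)] show ?case by (auto simp: jet_rats_def intro: rat_gen_divide)
  qed (auto simp: jet_rats_def intro: rat_gen.cst)
qed

subsection \<open>Derivations\<close>

text \<open>Covers partial and total derivatives, vector fields and their brackets alike; real
  linearity follows from the Leibniz rule and vanishing on constants.\<close>

locale jet_derivation =
  fixes D :: "jet_rat \<Rightarrow> jet_rat"
  assumes add: "D (f + g) = D f + D g"
    and mult: "D (f * g) = D f * g + f * D g"
    and cst [simp]: "D (cst c) = 0"
begin

lemma zero [simp]: "D 0 = 0" using cst[of 0] by simp

lemma one [simp]: "D 1 = 0" using cst[of 1] by simp

lemma uminus: "D (- f) = - D f"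
  using add[of f "- f"] by (simp add: eq_neg_iff_add_eq_0 add.commute)

lemma diff: "D (f - g) = D f - D g"
  using add[of f "- g"] by (simp add: uminus)

lemma of_nat [simp]: "D (of_nat n) = 0"
  using cst[of "of_nat n"] by (simp only: cst_of_nat)

lemma numeral [simp]: "D (numeral n) = 0"
  using of_nat[of "numeral n"] by simp

lemma sum: "D (sum f A) = (\<Sum>x\<in>A. D (f x))"
  by (induction A rule: infinite_finite_induct) (simp_all add: add)

lemma power: "D (f ^ n) = of_nat n * f ^ (n - 1) * D f"
proof (induction n)
  case (Suc n)
  then show ?case by (cases n) (simp_all add: mult algebra_simps)
qed simp

lemma divide: "g \<noteq> 0 \<Longrightarrow> D (f / g) = (D f - f / g * D g) / g"
  using mult[of "f / g" g] by (simp add: eq_divide_eq)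

text \<open>Logarithmic derivatives turn powers into multiples. Negative \<open>n\<close> matters:
  the exponent i + j - 1 is -1 at i = j = 0.\<close>

lemma power_int_eigen:
  assumes "D f = c * f" "f \<noteq> 0"
  shows "D (f powi n) = of_int n * c * f powi n"
proof -
  have pow: "D (f ^ m) = of_nat m * c * f ^ m" for m
    unfolding power assms(1) by (cases m) (simp_all add: algebra_simps)
  show ?thesis
  proof (cases n rule: int_cases2)
    case (nonneg m)
    then show ?thesis by (simp add: pow)
  next
    case (nonpos m)
    then have "f powi n = 1 / f ^ m" by (simp add: power_int_minus field_simps)
    then show ?thesis using assms(2) nonpos by (simp add: divide pow)
  qed
qed

text \<open>The kernel of a derivation is a subfield containing the real constants.\<close>

lemma zero_on_rat_gen:
  assumes "\<And>s. s \<in> S \<Longrightarrow> D s = 0" "f \<in> rat_gen S"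
  shows "D f = 0"
  using assms(2) by induction (simp_all add: assms(1) add mult divide)

lemma poly_zero_coeffs:
  assumes "\<And>i. D (coeff p i) = 0" "D t = 1"
  shows "D (poly p t) = poly (pderiv p) t"
  using assms(1)
proof (induction p)
  case (pCons a p)
  have "D (coeff p i) = 0" for i using pCons.prems[of "Suc i"] by simp
  moreover have "D a = 0" using pCons.prems[of 0] by simp
  ultimately show ?case
    by (simp add: pderiv_pCons add mult assms(2) pCons.IH)
qed simp

end

text \<open>Polynomials over the subfield \<open>rat_gen S\<close> stay polynomials over
  \<open>jet_rat\<close>, so the subfield needs no type of its own.\<close>

definition coeffs_in :: "jet_rat set \<Rightarrow> jet_rat poly \<Rightarrow> bool" where
  "coeffs_in S p \<longleftrightarrow> (\<forall>i. coeff p i \<in> rat_gen S)"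

lemma coeffs_in_const: "a \<in> rat_gen S \<Longrightarrow> coeffs_in S [:a:]"
  by (simp add: coeffs_in_def coeff_pCons split: nat.split)

lemma coeffs_in_pCons: "a \<in> rat_gen S \<Longrightarrow> coeffs_in S p \<Longrightarrow> coeffs_in S (pCons a p)"
  by (simp add: coeffs_in_def coeff_pCons split: nat.split)

lemma coeffs_in_add: "coeffs_in S p \<Longrightarrow> coeffs_in S q \<Longrightarrow> coeffs_in S (p + q)"
  by (simp add: coeffs_in_def rat_gen.add)

lemma coeffs_in_mult: "coeffs_in S p \<Longrightarrow> coeffs_in S q \<Longrightarrow> coeffs_in S (p * q)"
  by (simp add: coeffs_in_def coeff_mult rat_gen_sum rat_gen.mult)

lemma coeffs_in_power: "coeffs_in S p \<Longrightarrow> coeffs_in S (p ^ n)"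
  by (induction n) (simp_all add: coeffs_in_mult coeffs_in_const one_pCons)

lemma coeffs_in_sum: "(\<And>x. x \<in> A \<Longrightarrow> coeffs_in S (f x)) \<Longrightarrow> coeffs_in S (sum f A)"
  by (simp add: coeffs_in_def coeff_sum rat_gen_sum)

lemma coeffs_in_pderiv: "coeffs_in S p \<Longrightarrow> coeffs_in S (pderiv p)"
  unfolding coeffs_in_def coeff_pderiv
  by (metis rat_gen.mult rat_gen.cst cst_of_nat)

text \<open>Such quotients form a field. The condition is \<open>poly q t \<noteq> 0\<close> rather
  than \<open>q \<noteq> 0\<close>, because \<open>t\<close> may be algebraic over
  \<open>rat_gen S\<close>.\<close>

lemma rat_gen_insert_quotient:
  assumes "f \<in> rat_gen (insert t S)"
  shows "\<exists>p q. coeffs_in S p \<and> coeffs_in S q \<and> poly q t \<noteq> 0 \<and> f = poly p t / poly q t"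
  using assms
proof induction
  case (cst c)
  show ?case
    by (rule exI[of _ "[:cst c:]"], rule exI[of _ 1])
      (simp add: coeffs_in_const rat_gen.cst one_pCons)
next
  case (gen f)
  show ?case
  proof (cases "f = t")
    case True
    then show ?thesis
      by (intro exI[of _ "[:0, 1:]"] exI[of _ 1]) (simp add: coeffs_in_const coeffs_in_pCons one_pCons)
  next
    case False
    with gen show ?thesis
      by (intro exI[of _ "[:f:]"] exI[of _ 1]) (simp add: coeffs_in_const rat_gen.gen one_pCons)
  qed
next
  case (add f g)
  then obtain p q r s where *: "coeffs_in S p" "coeffs_in S q" "poly q t \<noteq> 0" "f = poly p t / poly q t"
    "coeffs_in S r" "coeffs_in S s" "poly s t \<noteq> 0" "g = poly r t / poly s t" by blast
  then show ?case
    by (intro exI[of _ "p * s + r * q"] exI[of _ "q * s"])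
      (simp add: coeffs_in_add coeffs_in_mult add_frac_eq)
next
  case (mult f g)
  then obtain p q r s where *: "coeffs_in S p" "coeffs_in S q" "poly q t \<noteq> 0" "f = poly p t / poly q t"
    "coeffs_in S r" "coeffs_in S s" "poly s t \<noteq> 0" "g = poly r t / poly s t" by blast
  then show ?case
    by (intro exI[of _ "p * r"] exI[of _ "q * s"]) (simp add: coeffs_in_mult)
next
  case (divide f g)
  then obtain p q r s where *: "coeffs_in S p" "coeffs_in S q" "poly q t \<noteq> 0" "f = poly p t / poly q t"
    "coeffs_in S r" "coeffs_in S s" "poly s t \<noteq> 0" "g = poly r t / poly s t" by blast
  with divide(3) show ?case
    by (intro exI[of _ "p * s"] exI[of _ "q * r"]) (simp add: coeffs_in_mult)
qed

context jet_derivation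
begin

text \<open>Applying \<open>D\<close> to a relation for \<open>t\<close> gives the relation with
  polynomial \<open>pderiv p\<close>, of smaller degree; descent leaves only constants.\<close>

lemma transcendental:
  assumes "\<And>s. s \<in> S \<Longrightarrow> D s = 0" "D t = 1" "coeffs_in S p" "poly p t = 0"
  shows "p = 0"
  using assms(3,4)
proof (induction "degree p" arbitrary: p rule: less_induct)
  case less
  have "D (coeff p i) = 0" for i
    using zero_on_rat_gen[of S] assms(1) less.prems by (auto simp: coeffs_in_def)
  from poly_zero_coeffs[OF this assms(2)] less.prems have *: "poly (pderiv p) t = 0" by simp
  have "degree p = 0"
  proof (rule ccontr)
    assume deg: "degree p \<noteq> 0"
    then have "pderiv p = 0"
      using less * by (simp add: degree_pderiv coeffs_in_pderiv)
    with deg show False by (simp add: pderiv_eq_0_iff)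
  qed
  with less.prems(2) show ?case by (auto elim!: degree_eq_zeroE)
qed

text \<open>
  Differentiating \<open>f \<cdot> q(t) = p(t)\<close> gives \<open>f \<cdot> q'(t) = p'(t)\<close>, so the degree of the denominator
  can be lowered until \<open>q\<close> and \<open>p\<close> are constant.
\<close>
lemma kernel_rat_gen_insert:
  assumes S: "\<And>s. s \<in> S \<Longrightarrow> D s = 0" and t: "D t = 1"
    and f: "f \<in> rat_gen (insert t S)" "D f = 0"
  shows "f \<in> rat_gen S"
proof -
  have coeffs: "D (coeff p i) = 0" if "coeffs_in S p" for p i
    using that zero_on_rat_gen[of S] S by (auto simp: coeffs_in_def)
  have der: "f * poly (pderiv q) t = poly (pderiv p) t"
    if "coeffs_in S p" "coeffs_in S q" "f * poly q t = poly p t" for p q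
    using arg_cong[OF that(3), of D] that(1,2)
    by (simp add: mult f(2) poly_zero_coeffs coeffs t)
  have "f \<in> rat_gen S"
    if "coeffs_in S p" "coeffs_in S q" "q \<noteq> 0" "f * poly q t = poly p t" for p q
    using that
  proof (induction "degree q" arbitrary: p q rule: less_induct)
    case less
    show ?case
    proof (cases "degree q = 0")
      case True
      then obtain c where c: "q = [:c:]" by (rule degree_eq_zeroE)
      \<comment> \<open>For constant \<open>q\<close>, \<open>der\<close> says that p' vanishes at
        \<open>t\<close>; transcendence of \<open>t\<close> then gives p' = 0.\<close>
      with der[OF less.prems(1,2,4)] have "poly (pderiv p) t = 0" by simp
      then have "pderiv p = 0"
        using transcendental[OF S t] coeffs_in_pderiv less.prems(1) by blast
      then obtain a where a: "p = [:a:]"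
        by (auto simp: pderiv_eq_0_iff elim: degree_eq_zeroE)
      have "c \<in> rat_gen S" "a \<in> rat_gen S"
        using less.prems(1,2) a c unfolding coeffs_in_def by (metis coeff_pCons_0)+
      moreover have "f = a / c" using less.prems(3,4) a c by (simp add: field_simps)
      ultimately show ?thesis by (simp add: rat_gen_divide)
    next
      case False
      then show ?thesis
        using less.hyps[of "pderiv q" "pderiv p"] less.prems der
        by (simp add: degree_pderiv coeffs_in_pderiv pderiv_eq_0_iff)
    qed
  qed
  moreover obtain p q where "coeffs_in S p" "coeffs_in S q" "poly q t \<noteq> 0" "f = poly p t / poly q t"
    using rat_gen_insert_quotient[OF f(1)] by blast
  ultimately show ?thesis by (metis nonzero_divide_eq_eq poly_0)
qed

end

subsection \<open>Vector fields on the jet spaces\<close>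

definition vf :: "(coord \<Rightarrow> jet_rat) \<Rightarrow> jet_rat \<Rightarrow> jet_rat" where
  "vf c f = (\<Sum>v | pd v f \<noteq> 0. c v * pd v f)"

lemma finite_pd_coord: "finite {v. pd v f \<noteq> 0}"
proof (rule finite_subset)
  show "{v. pd v f \<noteq> 0} \<subseteq> {X, Y} \<union> (\<lambda>(i, j). U i j) ` {(i, j). pd (U i j) f \<noteq> 0}"
  proof
    fix v assume "v \<in> {v. pd v f \<noteq> 0}"
    then show "v \<in> {X, Y} \<union> (\<lambda>(i, j). U i j) ` {(i, j). pd (U i j) f \<noteq> 0}"
      by (cases v) force+
  qed
qed (use finite_pd in auto)

lemma vf_superset: "finite M \<Longrightarrow> {v. pd v f \<noteq> 0} \<subseteq> M \<Longrightarrow> vf c f = (\<Sum>v\<in>M. c v * pd v f)"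
  unfolding vf_def by (rule sum.mono_neutral_left) auto

interpretation vf: jet_derivation "vf c" for c
proof
  fix f g
  let ?M = "{v. pd v f \<noteq> 0} \<union> {v. pd v g \<noteq> 0}"
  have fin: "finite ?M" by (simp add: finite_pd_coord)
  have *: "vf c h = (\<Sum>v\<in>?M. c v * pd v h)" if "h \<in> {f, g, f + g, f * g}" for h
    by (rule vf_superset[OF fin]) (use that in \<open>auto simp: pd_add pd_mult\<close>)
  show "vf c (f + g) = vf c f + vf c g"
    by (simp add: * pd_add sum.distrib distrib_left)
  show "vf c (f * g) = vf c f * g + f * vf c g"
    by (simp add: * pd_mult sum.distrib sum_distrib_left sum_distrib_right algebra_simps)
qed (simp add: vf_def)

lemma vf_var [simp]: "vf c (var v) = c v"
  by (subst vf_superset[of "{v}"]) (auto simp: pd_var)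

lemma vf_add: "vf (\<lambda>v. c v + d v) f = vf c f + vf d f"
  by (simp add: vf_def distrib_right sum.distrib)

lemma vf_scale: "vf (\<lambda>v. a * c v) f = a * vf c f"
  by (simp add: vf_def sum_distrib_left mult.assoc)

text \<open>The mixed products of first derivatives cancel.\<close>

lemma jet_derivation_commutator:
  assumes "jet_derivation D" "jet_derivation E"
  shows "jet_derivation (\<lambda>f. D (E f) - E (D f))"
proof -
  interpret D: jet_derivation D by fact
  interpret E: jet_derivation E by fact
  show ?thesis
    by standard (simp_all add: D.add E.add D.mult E.mult algebra_simps)
qed

lemma jet_derivation_plus:
  assumes "jet_derivation D" "jet_derivation E"
  shows "jet_derivation (\<lambda>f. D f + E f)"
proof -
  interpret D: jet_derivation D by fact
  interpret E: jet_derivation E by fact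
  show ?thesis
    by standard (simp_all add: D.add E.add D.mult E.mult algebra_simps)
qed

lemma jet_derivation_scale:
  assumes "jet_derivation D"
  shows "jet_derivation (\<lambda>f. c * D f)"
proof -
  interpret D: jet_derivation D by fact
  show ?thesis by standard (simp_all add: D.add D.mult algebra_simps)
qed

lemma tot_D_cst: "tot_D b (cst c) = 0"
  using tot_D_eq[of "{}" "cst c" b] by simp

interpretation Dx: jet_derivation Dx
  by standard (simp_all add: Dx_Dy_eq tot_D_add tot_D_mult tot_D_cst)

interpretation Dy: jet_derivation Dy
  by standard (simp_all add: Dx_Dy_eq tot_D_add tot_D_mult tot_D_cst)

interpretation pd: jet_derivation "pd v" for v
  by standard (simp_all add: pd_add pd_mult)

lemma Dx_u [simp]: "Dx (u i j) = u (Suc i) j" and Dy_u [simp]: "Dy (u i j) = u i (Suc j)"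
  by (simp_all add: Dx_Dy_eq tot_D_var shift_def)

declare Dx_Dy_base [simp]

subsection \<open>The affine and scaling vector fields\<close>

text \<open>The \<open>U\<close> case is the closed form of the prolongation plus \<open>w\<close>
  times \<open>\<gamma>\<close>. Where \<open>i - 1\<close> or \<open>j - 1\<close> is truncated,
  the factor \<open>of_nat i\<close> or \<open>of_nat j\<close> is zero.\<close>

fun aff_coeff where
  "aff_coeff a0 a1 a2 b0 b1 b2 w X = a0 + a1 * var X + a2 * var Y"
| "aff_coeff a0 a1 a2 b0 b1 b2 w Y = b0 + b1 * var X + b2 * var Y"
| "aff_coeff a0 a1 a2 b0 b1 b2 w (U i j) = (w - of_nat i * a1 - of_nat j * b2) * u i j
     - of_nat j * a2 * u (Suc i) (j - 1) - of_nat i * b1 * u (i - 1) (Suc j)"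

text \<open>
  For constant parameters \<open>aff_vf\<close> is the sum of the prolongation of an affine vector field and
  \<open>w\<close> times \<open>\<gamma>\<close>. Arbitrary rational functions are allowed as parameters, because the resulting
  linear combinations of these fields annihilate the same functions.
\<close>
abbreviation aff_vf where
  "aff_vf a0 a1 a2 b0 b1 b2 w \<equiv> vf (aff_coeff a0 a1 a2 b0 b1 b2 w)"

lemma aff_vf_linear:
  "aff_vf a0 a1 a2 b0 b1 b2 w f =
     a0 * aff_vf 1 0 0 0 0 0 0 f + a1 * aff_vf 0 1 0 0 0 0 0 f + a2 * aff_vf 0 0 1 0 0 0 0 f +
     b0 * aff_vf 0 0 0 1 0 0 0 f + b1 * aff_vf 0 0 0 0 1 0 0 f + b2 * aff_vf 0 0 0 0 0 1 0 f +
     w * aff_vf 0 0 0 0 0 0 1 f"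
proof -
  have "aff_coeff a0 a1 a2 b0 b1 b2 w = (\<lambda>v.
     a0 * aff_coeff 1 0 0 0 0 0 0 v + a1 * aff_coeff 0 1 0 0 0 0 0 v + a2 * aff_coeff 0 0 1 0 0 0 0 v +
     b0 * aff_coeff 0 0 0 1 0 0 0 v + b1 * aff_coeff 0 0 0 0 1 0 0 v + b2 * aff_coeff 0 0 0 0 0 1 0 v +
     w * aff_coeff 0 0 0 0 0 0 1 v)"
  proof
    fix v show "aff_coeff a0 a1 a2 b0 b1 b2 w v =
     a0 * aff_coeff 1 0 0 0 0 0 0 v + a1 * aff_coeff 0 1 0 0 0 0 0 v + a2 * aff_coeff 0 0 1 0 0 0 0 v +
     b0 * aff_coeff 0 0 0 1 0 0 0 v + b1 * aff_coeff 0 0 0 0 1 0 0 v + b2 * aff_coeff 0 0 0 0 0 1 0 v +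
     w * aff_coeff 0 0 0 0 0 0 1 v"
      by (cases v) (simp_all add: algebra_simps)
  qed
  then show ?thesis by (simp only: vf_add vf_scale)
qed

text \<open>The defining condition of curve invariants, freed from the jet order.\<close>

definition aff_scale_invariant :: "jet_rat \<Rightarrow> bool" where
  "aff_scale_invariant f \<longleftrightarrow> (\<forall>a0 a1 a2 b0 b1 b2 w.
     aff_vf (cst a0) (cst a1) (cst a2) (cst b0) (cst b1) (cst b2) (cst w) f = 0)"

lemma aff_scale_invariant_vf:
  assumes "aff_scale_invariant f"
  shows "aff_vf a0 a1 a2 b0 b1 b2 w f = 0"
proof -
  note * = assms[unfolded aff_scale_invariant_def, rule_format]
  show ?thesis
    unfolding aff_vf_linear[of a0 a1 a2 b0 b1 b2 w]
    using *[of 1 0 0 0 0 0 0] *[of 0 1 0 0 0 0 0] *[of 0 0 1 0 0 0 0] *[of 0 0 0 1 0 0 0]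
      *[of 0 0 0 0 1 0 0] *[of 0 0 0 0 0 1 0] *[of 0 0 0 0 0 0 1]
    by simp
qed

section \<open>Agreement with prolongation and scaling of finite order\<close>

lemma pd_high_order: "f \<in> jet_rats k \<Longrightarrow> k < i + j \<Longrightarrow> pd (U i j) f = 0"
  unfolding jet_rats_def by (rule pd.zero_on_rat_gen) (auto simp: pd_var)

lemma finite_order_le: "finite {(i, j). i + j \<le> (k::nat)}"
  by (rule finite_subset[of _ "{..k} \<times> {..k}"]) auto

lemma vf_jet_rats:
  assumes "f \<in> jet_rats k"
  shows "vf c f = c X * pd X f + c Y * pd Y f + (\<Sum>(i, j) | i + j \<le> k. c (U i j) * pd (U i j) f)"
proof -
  let ?A = "{(i, j). i + j \<le> k}"
  have inj: "inj_on (\<lambda>(i, j). U i j) ?A" by (auto simp: inj_on_def)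
  have "{v. pd v f \<noteq> 0} \<subseteq> {X, Y} \<union> (\<lambda>(i, j). U i j) ` ?A"
  proof
    fix v assume "v \<in> {v. pd v f \<noteq> 0}"
    then show "v \<in> {X, Y} \<union> (\<lambda>(i, j). U i j) ` ?A"
      using pd_high_order[OF assms] by (cases v) (auto simp: not_less[symmetric])
  qed
  then have "vf c f = (\<Sum>v\<in>{X, Y} \<union> (\<lambda>(i, j). U i j) ` ?A. c v * pd v f)"
    using vf_superset finite_order_le by simp
  also have "\<dots> = (\<Sum>v\<in>{X, Y}. c v * pd v f) + (\<Sum>v\<in>(\<lambda>(i, j). U i j) ` ?A. c v * pd v f)"
    by (rule sum.union_disjoint) (auto simp: finite_order_le)
  finally show ?thesis
    unfolding sum.reindex[OF inj] by (simp add: case_prod_unfold)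
qed

text \<open>Second derivatives of \<open>a\<close> and \<open>b\<close> vanish, so the Leibniz
  expansion stops after first-order corrections; its top-order terms cancel those added in
  \<open>prolong_coeff\<close>.\<close>

lemma prolong_coeff_affine:
  fixes a0 a1 a2 b0 b1 b2 :: real
  defines "a \<equiv> cst a0 + cst a1 * var X + cst a2 * var Y"
    and "b \<equiv> cst b0 + cst b1 * var X + cst b2 * var Y"
  shows "prolong_coeff (a, b) i j =
    aff_coeff (cst a0) (cst a1) (cst a2) (cst b0) (cst b1) (cst b2) 0 (U i j)"
proof -
  have D: "Dx a = cst a1" "Dy a = cst a2" "Dx b = cst b1" "Dy b = cst b2"
    by (simp_all add: a_def b_def Dx.add Dy.add Dx.mult Dy.mult)
  have y: "(Dy ^^ j) (- a * u 1 0 - b * u 0 1) =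
      - a * u 1 j - b * u 0 (Suc j) - of_nat j * (cst a2 * u 1 (j - 1) + cst b2 * u 0 j)" for j
  proof (induction j)
    case (Suc j)
    show ?case
      unfolding funpow.simps o_apply Suc.IH
      by (cases j) (simp_all add: Dy.add Dy.diff Dy.uminus Dy.mult D algebra_simps)
  qed simp
  have x: "(Dx ^^ i) (- a * u 1 j - b * u 0 (Suc j) - of_nat j * (cst a2 * u 1 (j - 1) + cst b2 * u 0 j)) =
      - a * u (Suc i) j - b * u i (Suc j) - of_nat j * (cst a2 * u (Suc i) (j - 1) + cst b2 * u i j)
      - of_nat i * (cst a1 * u i j + cst b1 * u (i - 1) (Suc j))"
  proof (induction i)
    case (Suc i)
    show ?case
      unfolding funpow.simps o_apply Suc.IH
      by (cases i) (simp_all add: Dx.add Dx.diff Dx.uminus Dx.mult D algebra_simps)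
  qed simp
  show ?thesis
    unfolding prolong_coeff_def prod.case y x by (simp add: algebra_simps)
qed

lemma aff_vf_jet_rats:
  assumes "f \<in> jet_rats k"
  shows "aff_vf (cst a0) (cst a1) (cst a2) (cst b0) (cst b1) (cst b2) (cst w) f =
    prolong k (cst a0 + cst a1 * var X + cst a2 * var Y, cst b0 + cst b1 * var X + cst b2 * var Y) f +
    cst w * scaling_field k f"
proof -
  have "(\<Sum>(i, j) | i + j \<le> k.
      aff_coeff (cst a0) (cst a1) (cst a2) (cst b0) (cst b1) (cst b2) (cst w) (U i j) * pd (U i j) f) =
    (\<Sum>(i, j) | i + j \<le> k.
      aff_coeff (cst a0) (cst a1) (cst a2) (cst b0) (cst b1) (cst b2) 0 (U i j) * pd (U i j) f) +
    cst w * (\<Sum>(i, j) | i + j \<le> k. u i j * pd (U i j) f)"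
    unfolding sum_distrib_left sum.distrib[symmetric]
    by (rule sum.cong) (auto simp: algebra_simps)
  then show ?thesis
    by (simp add: vf_jet_rats[OF assms] prolong_def scaling_field_def prolong_coeff_affine
        del: aff_coeff.simps(3))
qed

lemma curve_invariants_iff:
  "f \<in> curve_invariants k \<longleftrightarrow> f \<in> jet_rats k \<and> aff_scale_invariant f"
proof (cases "f \<in> jet_rats k")
  case True
  have "prolong k V f = 0" if inv: "aff_scale_invariant f" and V: "V \<in> aff2" for V
  proof -
    from V obtain a0 a1 a2 b0 b1 b2 where
      V: "V = (cst a0 + cst a1 * var X + cst a2 * var Y, cst b0 + cst b1 * var X + cst b2 * var Y)"
      unfolding aff2_def by blast
    show ?thesis
      using aff_vf_jet_rats[OF True, of a0 a1 a2 b0 b1 b2 0] aff_scale_invariant_vf[OF inv]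
      by (simp add: V)
  qed
  moreover have "scaling_field k f = 0"
    if inv: "aff_scale_invariant f" and p: "\<And>V. V \<in> aff2 \<Longrightarrow> prolong k V f = 0"
  proof -
    \<comment> \<open>The zero affine field together with \<open>w = 1\<close> isolates
      \<open>scaling_field\<close>.\<close>
    have "(cst 0 + cst 0 * var X + cst 0 * var Y, cst 0 + cst 0 * var X + cst 0 * var Y) \<in> aff2"
      unfolding aff2_def by blast
    from p[OF this] show ?thesis
      using aff_vf_jet_rats[OF True, of 0 0 0 0 0 0 1] aff_scale_invariant_vf[OF inv] by simp
  qed
  moreover have "aff_scale_invariant f"
    if "\<And>V. V \<in> aff2 \<Longrightarrow> prolong k V f = 0" "scaling_field k f = 0"
    unfolding aff_scale_invariant_def
  proof (intro allI)
    fix a0 a1 a2 b0 b1 b2 w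
    have "(cst a0 + cst a1 * var X + cst a2 * var Y, cst b0 + cst b1 * var X + cst b2 * var Y) \<in> aff2"
      unfolding aff2_def by blast
    from that(1)[OF this] that(2)
    show "aff_vf (cst a0) (cst a1) (cst a2) (cst b0) (cst b1) (cst b2) (cst w) f = 0"
      by (simp add: aff_vf_jet_rats[OF True])
  qed
  ultimately show ?thesis
    using True unfolding curve_invariants_def affine_invariants_def by blast
qed (simp add: curve_invariants_def affine_invariants_def)

subsection \<open>Action on the coframe\<close>

text \<open>Evaluates the tensor identity on the vector (\<xi>, \<eta>); \<open>dy\<close> is the
  outer polynomial variable, \<open>dx\<close> the inner one.\<close>

lemma coframe_coeffs_eval:
  assumes "coframe_coeffs I"
  shows "(\<Sum>i\<le>k. cst (1 / (fact i * fact (k - i))) * u i (k - i) * \<xi> ^ i * \<eta> ^ (k - i)) =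
    (\<Sum>i\<le>k. cst (1 / (fact i * fact (k - i))) * I i (k - i) *
      (u 1 0 * \<xi> + u 0 1 * \<eta>) ^ i * (Dx I2 * \<xi> + Dy I2 * \<eta>) ^ (k - i))"
proof -
  let ?ev = "\<lambda>t. poly (poly t [:\<eta>:]) \<xi>"
  have ev: "?ev (scal f) = f" "?ev dx = \<xi>" "?ev dy = \<eta>" for f
    by (simp_all add: scal_def dx_def dy_def)
  have "?ev (\<Theta> k) = ?ev (\<Sum>i\<le>k. scal (cst (1 / (fact i * fact (k - i))) * I i (k - i)) *
      \<omega>1 ^ i * \<omega>2 ^ (k - i))"
    using assms by (simp only: coframe_coeffs_def)
  then show ?thesis
    by (simp only: \<Theta>_def coframe_1 coframe_2 poly_sum poly_mult poly_power poly_add ev)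
qed

text \<open>An index shift absorbs the factor into the factorials. It will cancel the off-diagonal
  terms in the Lie derivative of \<open>\<Theta> k\<close>.\<close>

lemma euler_sum_shift:
  fixes g :: "nat \<Rightarrow> nat \<Rightarrow> jet_rat"
  shows "(\<Sum>i\<le>k. of_nat i * cst (1 / (fact i * fact (k - i))) * g i (k - i)) =
    (\<Sum>i\<le>k. of_nat (k - i) * cst (1 / (fact i * fact (k - i))) * g (Suc i) (k - i - 1))"
proof (cases k)
  case (Suc m)
  have l: "of_nat (Suc i) * cst (1 / (fact (Suc i) * fact j)) = cst (1 / (fact i * fact j))" for i j
    by (simp flip: cst_of_nat cst_mult add: field_simps del: of_nat_Suc)
  have r: "of_nat (Suc j) * cst (1 / (fact i * fact (Suc j))) = cst (1 / (fact i * fact j))" for i j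
    by (simp flip: cst_of_nat cst_mult add: field_simps del: of_nat_Suc)
  have "(\<Sum>i\<le>k. of_nat i * cst (1 / (fact i * fact (k - i))) * g i (k - i)) =
      (\<Sum>i\<le>m. of_nat (Suc i) * cst (1 / (fact (Suc i) * fact (m - i))) * g (Suc i) (m - i))"
    unfolding Suc sum.atMost_Suc_shift by simp
  also have "\<dots> = (\<Sum>i\<le>m. cst (1 / (fact i * fact (m - i))) * g (Suc i) (m - i))"
    by (simp only: l)
  also have "\<dots> = (\<Sum>i\<le>m. of_nat (Suc (m - i)) * cst (1 / (fact i * fact (Suc (m - i)))) * g (Suc i) (m - i))"
    by (simp only: r)
  also have "\<dots> = (\<Sum>i\<le>k. of_nat (k - i) * cst (1 / (fact i * fact (k - i))) * g (Suc i) (k - i - 1))"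
    unfolding Suc sum.atMost_Suc by (simp add: Suc_diff_le del: fact_Suc of_nat_Suc)
  finally show ?thesis .
qed simp

text \<open>There are infinitely many real constants, but a nonzero polynomial has finitely many
  roots.\<close>

lemma poly_zero_on_constants:
  assumes "\<And>c. poly p (cst c) = 0"
  shows "p = 0"
proof (rule ccontr)
  assume "p \<noteq> 0"
  then have "finite (range cst)"
    using poly_roots_finite[of p] assms by (auto elim: rev_finite_subset)
  then show False
    by (simp add: finite_image_iff inj_def infinite_UNIV_char_0)
qed

section \<open>Weights of \<open>I2\<close>, the coframe and its coefficients\<close>

context
  fixes a0 a1 a2 b0 b1 b2 w :: real
begin

abbreviation W where
  "W \<equiv> aff_vf (cst a0) (cst a1) (cst a2) (cst b0) (cst b1) (cst b2) (cst w)"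

text \<open>The bracket of \<open>W\<close> with \<open>Dx\<close> comes from the x-derivatives
  \<open>a1\<close>, \<open>b1\<close> of the affine field; scaling commutes with \<open>Dx\<close>.
  The defect \<open>?E\<close> is a derivation killing all coordinates, hence zero.\<close>

lemma W_Dx: "W (Dx f) = Dx (W f) - cst a1 * Dx f - cst b1 * Dy f"
proof -
  let ?E = "\<lambda>f. (W (Dx f) - Dx (W f)) + (cst a1 * Dx f + cst b1 * Dy f)"
  interpret E: jet_derivation ?E
    by (intro jet_derivation_plus jet_derivation_commutator jet_derivation_scale
        vf.jet_derivation_axioms Dx.jet_derivation_axioms Dy.jet_derivation_axioms)
  have "?E (var v) = 0" for v
  proof (cases v)
    case (U i j)
    then show ?thesis
      by (cases i; cases j) (simp_all add: Dx.add Dx.diff Dx.mult algebra_simps)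
  qed (simp_all add: Dx.add Dx.mult)
  then have "?E f = 0"
    using E.zero_on_rat_gen[of "range var"] rat_gen_range_var by blast
  then show ?thesis by algebra
qed

lemma W_Dy: "W (Dy f) = Dy (W f) - cst a2 * Dx f - cst b2 * Dy f"
proof -
  let ?E = "\<lambda>f. (W (Dy f) - Dy (W f)) + (cst a2 * Dx f + cst b2 * Dy f)"
  interpret E: jet_derivation ?E
    by (intro jet_derivation_plus jet_derivation_commutator jet_derivation_scale
        vf.jet_derivation_axioms Dx.jet_derivation_axioms Dy.jet_derivation_axioms)
  have "?E (var v) = 0" for v
  proof (cases v)
    case (U i j)
    then show ?thesis
      by (cases i; cases j) (simp_all add: Dy.add Dy.diff Dy.mult algebra_simps)
  qed (simp_all add: Dy.add Dy.mult)
  then have "?E f = 0"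
    using E.zero_on_rat_gen[of "range var"] rat_gen_range_var by blast
  then show ?thesis by algebra
qed

text \<open>Numerator and denominator are relative invariants with the same trace factor and scaling
  weights 3 and 2.\<close>

lemma W_I2: "W I2 = cst w * I2"
proof -
  have num: "W I2_num = (3 * cst w - 2 * (cst a1 + cst b2)) * I2_num"
    by (simp add: vf.add vf.diff vf.mult vf.power numeral_2_eq_2 numeral_3_eq_3 algebra_simps)
  have den: "W I2_den = (2 * cst w - 2 * (cst a1 + cst b2)) * I2_den"
    by (simp add: vf.add vf.diff vf.mult vf.power numeral_2_eq_2 numeral_3_eq_3 algebra_simps)
  have "W I2 = (W I2_num - I2 * W I2_den) / I2_den"
    unfolding I2_def by (rule vf.divide[OF I2_den_nonzero])
  also have "\<dots> = ((3 * cst w - 2 * (cst a1 + cst b2)) * (I2_num / I2_den) * I2_den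
      - I2 * (2 * cst w - 2 * (cst a1 + cst b2)) * I2_den) / I2_den"
    unfolding num den using I2_den_nonzero by (simp add: mult_ac)
  also have "\<dots> = cst w * I2"
    unfolding I2_def[symmetric] using I2_den_nonzero by (simp add: divide_eq_eq algebra_simps)
  finally show ?thesis .
qed

text \<open>Since \<open>u 0 0\<close> and \<open>I2\<close> both have weight one, the components of
  \<open>\<omega>1\<close> and \<open>\<omega>2\<close> obey the same linear law.\<close>

lemma W_coframe:
  "W (u 1 0) = cst w * u 1 0 - cst a1 * u 1 0 - cst b1 * u 0 1"
  "W (u 0 1) = cst w * u 0 1 - cst a2 * u 1 0 - cst b2 * u 0 1"
  "W (Dx I2) = cst w * Dx I2 - cst a1 * Dx I2 - cst b1 * Dy I2"
  "W (Dy I2) = cst w * Dy I2 - cst a2 * Dx I2 - cst b2 * Dy I2"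
  by (simp_all add: W_Dx W_Dy W_I2 Dx.mult Dy.mult algebra_simps)

text \<open>The assumptions are the law dual to that of the coframe. The \<open>a1\<close> and
  \<open>b2\<close> terms cancel; the rest is shaped for \<open>euler_sum_shift\<close>, whence
  \<open>Suc (j - 1)\<close>.\<close>

lemma W_tensor_term:
  assumes "W \<xi> = cst a1 * \<xi> + cst a2 * \<eta> - cst w * \<xi>"
    and "W \<eta> = cst b1 * \<xi> + cst b2 * \<eta> - cst w * \<eta>"
  shows "W (cst c * u i j * \<xi> ^ i * \<eta> ^ j) =
    cst w * (1 - of_nat (i + j)) * (cst c * u i j * \<xi> ^ i * \<eta> ^ j) +
    cst a2 * (of_nat i * cst c * (u i j * \<xi> ^ (i - 1) * \<eta> ^ Suc j) -
      of_nat j * cst c * (u (Suc i) (j - 1) * \<xi> ^ i * \<eta> ^ Suc (j - 1))) +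
    cst b1 * (of_nat j * cst c * (u i (Suc (j - 1)) * \<xi> ^ Suc i * \<eta> ^ (j - 1)) -
      of_nat i * cst c * (u (i - 1) (Suc j) * \<xi> ^ i * \<eta> ^ j))"
  by (cases i; cases j)
    (simp_all add: vf.mult vf.power assms del: power_Suc, simp_all add: algebra_simps)

text \<open>The Lie derivative of \<open>\<Theta>\<^sub>k\<close> along an affine vector field vanishes.\<close>
lemma W_tensor:
  fixes k :: nat and \<xi> \<eta> :: jet_rat
  assumes "W \<xi> = cst a1 * \<xi> + cst a2 * \<eta> - cst w * \<xi>"
    and "W \<eta> = cst b1 * \<xi> + cst b2 * \<eta> - cst w * \<eta>"
  defines "G \<equiv> \<Sum>i\<le>k. cst (1 / (fact i * fact (k - i))) * u i (k - i) * \<xi> ^ i * \<eta> ^ (k - i)"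
  shows "W G = cst w * (1 - of_nat k) * G"
proof -
  let ?c = "\<lambda>i. cst (1 / (fact i * fact (k - i)))"
  have "W G = (\<Sum>i\<le>k. cst w * (1 - of_nat k) * (?c i * u i (k - i) * \<xi> ^ i * \<eta> ^ (k - i)) +
    cst a2 * (of_nat i * ?c i * (u i (k - i) * \<xi> ^ (i - 1) * \<eta> ^ Suc (k - i)) -
      of_nat (k - i) * ?c i * (u (Suc i) (k - i - 1) * \<xi> ^ i * \<eta> ^ Suc (k - i - 1))) +
    cst b1 * (of_nat (k - i) * ?c i * (u i (Suc (k - i - 1)) * \<xi> ^ Suc i * \<eta> ^ (k - i - 1)) -
      of_nat i * ?c i * (u (i - 1) (Suc (k - i)) * \<xi> ^ i * \<eta> ^ (k - i))))"
    unfolding G_def vf.sum W_tensor_term[OF assms(1,2)] by (rule sum.cong) auto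
  \<comment> \<open>The two shifts cancel the sums multiplied by \<open>a2\<close> and
    \<open>b1\<close>.\<close>
  also have "\<dots> = cst w * (1 - of_nat k) * G"
    unfolding sum.distrib sum_distrib_left[symmetric] sum_subtractf G_def
    using euler_sum_shift[where k = k and g = "\<lambda>i j. u i j * \<xi> ^ (i - 1) * \<eta> ^ Suc j"]
      euler_sum_shift[where k = k and g = "\<lambda>i j. u (i - 1) (Suc j) * \<xi> ^ i * \<eta> ^ j"]
    by simp
  finally show ?thesis .
qed

text \<open>
  \<open>(\<xi>, \<eta>)\<close> is the vector with \<open>\<omega>\<^sub>1(\<xi>, \<eta>) = c\<close> and \<open>\<omega>\<^sub>2(\<xi>, \<eta>) = 1\<close>, so that \<open>\<Theta>\<^sub>k(\<xi>, \<eta>)\<close> is a polynomial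
  in \<open>c\<close> with the coefficients of \<open>I\<close>; infinitely many values of \<open>c\<close> separate them.
\<close>
lemma W_coframe_coeffs:
  assumes "coframe_coeffs I"
  shows "W (I i j) = cst w * (1 - of_nat (i + j)) * I i j"
proof -
  define k where "k = i + j"
  let ?c = "\<lambda>i. cst (1 / (fact i * fact (k - i)))"
  define J where "J i = W (I i (k - i)) - cst w * (1 - of_nat k) * I i (k - i)" for i
  define \<Delta> where "\<Delta> = u 1 0 * Dy I2 - u 0 1 * Dx I2"
  have \<Delta>: "\<Delta> \<noteq> 0" unfolding \<Delta>_def by (rule coframe_det_nonzero)
  define p where "p = (\<Sum>i\<le>k. monom (?c i * J i) i)"
  have "poly p (cst c) = 0" for c
  proof -
    \<comment> \<open>Cramer's rule for the two conditions on (\<xi>, \<eta>).\<close>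
    define \<xi> where "\<xi> = (cst c * Dy I2 - u 0 1) / \<Delta>"
    define \<eta> where "\<eta> = (u 1 0 - cst c * Dx I2) / \<Delta>"
    have "u 1 0 * \<xi> + u 0 1 * \<eta> = cst c * \<Delta> / \<Delta>"
      unfolding \<xi>_def \<eta>_def times_divide_eq_right add_divide_distrib[symmetric]
      by (simp add: \<Delta>_def algebra_simps)
    then have 1: "u 1 0 * \<xi> + u 0 1 * \<eta> = cst c" using \<Delta> by simp
    have "Dx I2 * \<xi> + Dy I2 * \<eta> = \<Delta> / \<Delta>"
      unfolding \<xi>_def \<eta>_def times_divide_eq_right add_divide_distrib[symmetric]
      by (simp add: \<Delta>_def algebra_simps)
    then have 2: "Dx I2 * \<xi> + Dy I2 * \<eta> = 1" using \<Delta> by simp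
    \<comment> \<open>\<open>A\<close> and \<open>B\<close> measure the failure of the hypotheses of
      \<open>W_tensor\<close>. Applying \<open>W\<close> to the constant pairings gives a
      homogeneous system for them with determinant \<open>\<Delta>\<close>.\<close>
    define A where "A = W \<xi> - (cst a1 * \<xi> + cst a2 * \<eta> - cst w * \<xi>)"
    define B where "B = W \<eta> - (cst b1 * \<xi> + cst b2 * \<eta> - cst w * \<eta>)"
    have A: "W \<xi> = A + (cst a1 * \<xi> + cst a2 * \<eta> - cst w * \<xi>)"
      and B: "W \<eta> = B + (cst b1 * \<xi> + cst b2 * \<eta> - cst w * \<eta>)"
      by (simp_all add: A_def B_def)
    have e1: "u 1 0 * A + u 0 1 * B = 0"
      using arg_cong[OF 1, of W] unfolding vf.add vf.mult W_coframe A B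
      by (simp add: algebra_simps)
    have e2: "Dx I2 * A + Dy I2 * B = 0"
      using arg_cong[OF 2, of W] unfolding vf.add vf.mult W_coframe A B
      by (simp add: algebra_simps)
    have "\<Delta> * A = Dy I2 * (u 1 0 * A + u 0 1 * B) - u 0 1 * (Dx I2 * A + Dy I2 * B)"
      "\<Delta> * B = u 1 0 * (Dx I2 * A + Dy I2 * B) - Dx I2 * (u 1 0 * A + u 0 1 * B)"
      by (simp_all add: \<Delta>_def algebra_simps)
    then have "A = 0" "B = 0" using \<Delta> by (simp_all only: e1 e2) simp_all
    with W_tensor[of \<xi> \<eta> k] A B
    have "W (\<Sum>i\<le>k. ?c i * I i (k - i) * cst c ^ i) =
        cst w * (1 - of_nat k) * (\<Sum>i\<le>k. ?c i * I i (k - i) * cst c ^ i)"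
      unfolding coframe_coeffs_eval[OF assms] 1 2 by simp
    then have "(\<Sum>i\<le>k. ?c i * J i * cst c ^ i) = 0"
      by (simp add: vf.sum vf.mult vf.power J_def sum_distrib_left sum_subtractf sum.distrib algebra_simps)
    then show ?thesis by (simp add: p_def poly_sum poly_monom)
  qed
  from poly_zero_on_constants[OF this] have "coeff p i = 0" by simp
  then have "?c i * J i = 0" by (simp add: p_def coeff_sum k_def)
  moreover have "?c i \<noteq> 0" using cst_eq_iff[of _ 0] by (simp del: cst_eq_iff)
  ultimately show ?thesis by (simp add: J_def k_def)
qed

end

text \<open>The power of \<open>u 0 0\<close>, which has weight one, compensates the weight 1 - (i +
  j) of \<open>I i j\<close>.\<close>

lemma coframe_coeffs_invariant:
  assumes "coframe_coeffs I"
  shows "aff_scale_invariant (I i j * u 0 0 powi (int i + int j - 1))"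
  unfolding aff_scale_invariant_def
proof (intro allI)
  fix a0 a1 a2 b0 b1 b2 w
  let ?W = "aff_vf (cst a0) (cst a1) (cst a2) (cst b0) (cst b1) (cst b2) (cst w)"
  have "?W (u 0 0) = cst w * u 0 0" by simp
  from vf.power_int_eigen[OF this var_nonzero]
  show "?W (I i j * u 0 0 powi (int i + int j - 1)) = 0"
    by (simp add: vf.mult W_coframe_coeffs[OF assms] algebra_simps)
qed

subsection \<open>Elimination of the frame\<close>

lemma kernel_rat_gen_union:
  assumes "finite T"
    and "\<And>t. t \<in> T \<Longrightarrow> \<exists>D. jet_derivation D \<and> D t = 1 \<and> (\<forall>s\<in>T \<union> S - {t}. D s = 0) \<and> D f = 0"
    and "f \<in> rat_gen (T \<union> S)"
  shows "f \<in> rat_gen S"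
  using assms
proof (induction T rule: finite_induct)
  case (insert t T)
  show ?case
  proof (cases "t \<in> S")
    case True
    \<comment> \<open>The derivation for \<open>t\<close> does not kill all of \<open>S\<close>
      here, but there is nothing to eliminate.\<close>
    then have eq: "insert t T \<union> S = T \<union> S" by auto
    show ?thesis
    proof (rule insert.IH)
      fix s assume "s \<in> T"
      then show "\<exists>D. jet_derivation D \<and> D s = 1 \<and> (\<forall>r\<in>T \<union> S - {s}. D r = 0) \<and> D f = 0"
        using insert.prems(1)[of s] by (auto simp: eq)
    qed (use insert.prems(2) eq in simp)
  next
    case False
    obtain D where D: "jet_derivation D" "D t = 1" "D f = 0"
        "\<And>s. s \<in> T \<union> S \<Longrightarrow> D s = 0"
      using insert.prems(1)[of t] insert.hyps(2) False by auto
    have "f \<in> rat_gen (T \<union> S)"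
      using jet_derivation.kernel_rat_gen_insert[OF D(1), of "T \<union> S" t f] D insert.prems(2)
      by simp
    moreover have "\<exists>D. jet_derivation D \<and> D s = 1 \<and> (\<forall>r\<in>T \<union> S - {s}. D r = 0) \<and> D f = 0"
      if "s \<in> T" for s
      using insert.prems(1)[of s] that by blast
    ultimately show ?thesis by (intro insert.IH)
  qed
qed simp

definition frame :: "jet_rat set" where
  "frame = {var X, var Y, u 0 0, u 1 0, u 0 1, Dx I2, Dy I2}"

text \<open>Extends \<open>W_coframe\<close> from real to rational function parameters by linearity
  in the seven basic fields.\<close>

lemma aff_vf_coframe:
  "aff_vf a0 a1 a2 b0 b1 b2 w (u 1 0) = w * u 1 0 - a1 * u 1 0 - b1 * u 0 1"
  "aff_vf a0 a1 a2 b0 b1 b2 w (u 0 1) = w * u 0 1 - a2 * u 1 0 - b2 * u 0 1"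
  "aff_vf a0 a1 a2 b0 b1 b2 w (Dx I2) = w * Dx I2 - a1 * Dx I2 - b1 * Dy I2"
  "aff_vf a0 a1 a2 b0 b1 b2 w (Dy I2) = w * Dy I2 - a2 * Dx I2 - b2 * Dy I2"
proof -
  note c = W_coframe[of 1 0 0 0 0 0 0] W_coframe[of 0 1 0 0 0 0 0] W_coframe[of 0 0 1 0 0 0 0]
    W_coframe[of 0 0 0 1 0 0 0] W_coframe[of 0 0 0 0 1 0 0] W_coframe[of 0 0 0 0 0 1 0]
    W_coframe[of 0 0 0 0 0 0 1]
  show "aff_vf a0 a1 a2 b0 b1 b2 w (u 1 0) = w * u 1 0 - a1 * u 1 0 - b1 * u 0 1"
    "aff_vf a0 a1 a2 b0 b1 b2 w (u 0 1) = w * u 0 1 - a2 * u 1 0 - b2 * u 0 1"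
    by (simp_all add: algebra_simps)
  show "aff_vf a0 a1 a2 b0 b1 b2 w (Dx I2) = w * Dx I2 - a1 * Dx I2 - b1 * Dy I2"
    "aff_vf a0 a1 a2 b0 b1 b2 w (Dy I2) = w * Dy I2 - a2 * Dx I2 - b2 * Dy I2"
    unfolding aff_vf_linear[of a0 a1 a2 b0 b1 b2 w] using c by simp_all
qed

text \<open>The value at \<open>u 0 0\<close> fixes \<open>w\<close>; two linear systems with
  determinant \<open>\<Delta>\<close> then give \<open>a1\<close>, \<open>b1\<close> and
  \<open>a2\<close>, \<open>b2\<close>.\<close>

lemma frame_derivation:
  fixes \<tau> :: "jet_rat \<Rightarrow> jet_rat"
  shows "\<exists>D. jet_derivation D \<and> (\<forall>f. aff_scale_invariant f \<longrightarrow> D f = 0) \<and> (\<forall>t\<in>frame. D t = \<tau> t)"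
proof -
  define \<Delta> where "\<Delta> = u 1 0 * Dy I2 - u 0 1 * Dx I2"
  have \<Delta>: "\<Delta> \<noteq> 0" unfolding \<Delta>_def by (rule coframe_det_nonzero)
  have solve: "u 1 0 * ((r * Dy I2 - u 0 1 * s) / \<Delta>) + u 0 1 * ((u 1 0 * s - Dx I2 * r) / \<Delta>) = r"
    "Dx I2 * ((r * Dy I2 - u 0 1 * s) / \<Delta>) + Dy I2 * ((u 1 0 * s - Dx I2 * r) / \<Delta>) = s" for r s
  proof -
    have "r * \<Delta> / \<Delta> = r" "s * \<Delta> / \<Delta> = s" using \<Delta> by simp_all
    moreover have "u 1 0 * (r * Dy I2 - u 0 1 * s) + u 0 1 * (u 1 0 * s - Dx I2 * r) = r * \<Delta>"
      "Dx I2 * (r * Dy I2 - u 0 1 * s) + Dy I2 * (u 1 0 * s - Dx I2 * r) = s * \<Delta>"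
      by (simp_all add: \<Delta>_def algebra_simps)
    ultimately show
      "u 1 0 * ((r * Dy I2 - u 0 1 * s) / \<Delta>) + u 0 1 * ((u 1 0 * s - Dx I2 * r) / \<Delta>) = r"
      "Dx I2 * ((r * Dy I2 - u 0 1 * s) / \<Delta>) + Dy I2 * ((u 1 0 * s - Dx I2 * r) / \<Delta>) = s"
      unfolding times_divide_eq_right add_divide_distrib[symmetric] by simp_all
  qed
  have solve': "\<exists>p q. u 1 0 * p + u 0 1 * q = r \<and> Dx I2 * p + Dy I2 * q = s" for r s
    using solve by blast
  define w where "w = \<tau> (u 0 0) / u 0 0"
  obtain a1 b1 where 1: "u 1 0 * a1 + u 0 1 * b1 = w * u 1 0 - \<tau> (u 1 0)"
      "Dx I2 * a1 + Dy I2 * b1 = w * Dx I2 - \<tau> (Dx I2)"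
    using solve' by blast
  obtain a2 b2 where 2: "u 1 0 * a2 + u 0 1 * b2 = w * u 0 1 - \<tau> (u 0 1)"
      "Dx I2 * a2 + Dy I2 * b2 = w * Dy I2 - \<tau> (Dy I2)"
    using solve' by blast
  \<comment> \<open>The translation parameters correct the values at \<open>var X\<close> and
    \<open>var Y\<close>.\<close>
  let ?D = "aff_vf (\<tau> (var X) - a1 * var X - a2 * var Y) a1 a2
    (\<tau> (var Y) - b1 * var X - b2 * var Y) b1 b2 w"
  have "?D (u 1 0) = w * u 1 0 - (u 1 0 * a1 + u 0 1 * b1)"
    "?D (u 0 1) = w * u 0 1 - (u 1 0 * a2 + u 0 1 * b2)"
    "?D (Dx I2) = w * Dx I2 - (Dx I2 * a1 + Dy I2 * b1)"
    "?D (Dy I2) = w * Dy I2 - (Dx I2 * a2 + Dy I2 * b2)"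
    unfolding aff_vf_coframe by (simp_all add: algebra_simps)
  then have "?D (u 1 0) = \<tau> (u 1 0)" "?D (u 0 1) = \<tau> (u 0 1)"
    "?D (Dx I2) = \<tau> (Dx I2)" "?D (Dy I2) = \<tau> (Dy I2)"
    unfolding 1 2 by simp_all
  moreover have "?D (u 0 0) = \<tau> (u 0 0)" by (simp add: w_def var_nonzero)
  moreover have "?D (var X) = \<tau> (var X)" "?D (var Y) = \<tau> (var Y)" by simp_all
  ultimately have "\<forall>t\<in>frame. ?D t = \<tau> t" unfolding frame_def by blast
  then show ?thesis
    using vf.jet_derivation_axioms aff_scale_invariant_vf by blast
qed

lemma aff_scale_invariant_in_rat_gen:
  assumes S: "\<And>s. s \<in> S \<Longrightarrow> aff_scale_invariant s"
    and f: "aff_scale_invariant f" "f \<in> rat_gen (frame \<union> S)"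
  shows "f \<in> rat_gen S"
proof (rule kernel_rat_gen_union[OF _ _ f(2)])
  fix t assume "t \<in> frame"
  obtain D where D: "jet_derivation D" "\<And>g. aff_scale_invariant g \<Longrightarrow> D g = 0"
      "\<And>s. s \<in> frame \<Longrightarrow> D s = (if s = t then 1 else 0)"
    using frame_derivation[of "\<lambda>s. if s = t then 1 else 0"] by blast
  then show "\<exists>D. jet_derivation D \<and> D t = 1 \<and> (\<forall>s\<in>frame \<union> S - {t}. D s = 0) \<and> D f = 0"
    using \<open>t \<in> frame\<close> S f(1) by (intro exI[of _ D]) (auto split: if_splits)
qed (simp add: frame_def)

text \<open>Setting \<open>dy\<close> to 1 makes \<open>\<Theta> k\<close> a polynomial in
  \<open>dx\<close>; comparing coefficients expresses \<open>u i j\<close> through the frame and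
  \<open>I\<close>.\<close>

lemma u_in_rat_gen_frame:
  assumes "coframe_coeffs I" and S: "frame \<subseteq> rat_gen S" "\<And>i j. I i j \<in> rat_gen S"
  shows "u i j \<in> rat_gen S"
proof -
  define k where "k = i + j"
  let ?c = "\<lambda>i. cst (1 / (fact i * fact (k - i)))"
  let ?p = "\<lambda>t :: sym_tensor. poly t [:1:]"
  have p: "?p (scal g) = [:g:]" "?p dx = [:0, 1:]" "?p dy = [:1:]" for g
    by (simp_all add: scal_def dx_def dy_def)
  have "?p (\<Theta> k) = (\<Sum>i\<le>k. monom (?c i * u i (k - i)) i)"
    by (simp only: \<Theta>_def poly_sum poly_mult poly_power p monom_altdef)
      (simp add: one_pCons[symmetric])
  moreover have "?p (\<Theta> k) = (\<Sum>i\<le>k. [:?c i * I i (k - i):] *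
      [:u 0 1, u 1 0:] ^ i * [:Dy I2, Dx I2:] ^ (k - i))"
    using assms(1)
    by (simp only: coframe_coeffs_def coframe_1 coframe_2 poly_sum poly_mult poly_power poly_add p) simp
  moreover have "coeffs_in S \<dots>"
    using S unfolding frame_def
    by (intro coeffs_in_sum coeffs_in_mult coeffs_in_power coeffs_in_pCons coeffs_in_const
        rat_gen.mult rat_gen.cst) auto
  ultimately have "coeff (\<Sum>i\<le>k. monom (?c i * u i (k - i)) i) i \<in> rat_gen S"
    by (simp add: coeffs_in_def)
  then have "?c i * u i j \<in> rat_gen S" by (simp add: coeff_sum k_def)
  then have "?c i * u i j / ?c i \<in> rat_gen S" by (rule rat_gen_divide) (rule rat_gen.cst)
  moreover have "?c i \<noteq> 0" using cst_eq_iff[of _ 0] by (simp del: cst_eq_iff)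
  ultimately show ?thesis by simp
qed

theorem theorem31:
  fixes I :: "nat \<Rightarrow> nat \<Rightarrow> jet_rat"
  assumes "coframe_coeffs I"
  shows "(\<forall>i j. \<exists>k. I i j * u 0 0 powi (int i + int j - 1) \<in> curve_invariants k) \<and>
    (\<forall>k. curve_invariants k \<subseteq>
       rat_gen {I i j * u 0 0 powi (int i + int j - 1) | i j. True})"
proof (intro conjI allI subsetI)
  fix i j
  show "\<exists>k. I i j * u 0 0 powi (int i + int j - 1) \<in> curve_invariants k"
    unfolding curve_invariants_iff using in_jet_rats coframe_coeffs_invariant[OF assms] by blast
next
  fix k f assume "f \<in> curve_invariants k"
  then have f: "aff_scale_invariant f" by (simp add: curve_invariants_iff)
  let ?J = "{I i j * u 0 0 powi (int i + int j - 1) | i j. True}"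
  let ?F = "rat_gen (frame \<union> ?J)"
  have frame: "frame \<subseteq> ?F" by (auto intro: rat_gen.gen)
  have "I i j \<in> ?F" for i j
  proof -
    \<comment> \<open>The power of \<open>u 0 0\<close> can be divided out because
      \<open>u 0 0\<close> belongs to \<open>frame\<close>.\<close>
    have "I i j * u 0 0 powi (int i + int j - 1) / u 0 0 powi (int i + int j - 1) \<in> ?F"
      using frame by (intro rat_gen_divide rat_gen_power_int)
        (auto simp: frame_def intro: rat_gen.gen)
    then show ?thesis by (simp add: var_nonzero)
  qed
  then have u: "u i j \<in> ?F" for i j
    using u_in_rat_gen_frame[OF assms frame] by blast
  \<comment> \<open>Hence \<open>?F\<close> is the whole field, and eliminating \<open>frame\<close>
    finishes the proof.\<close>
  have "var v \<in> ?F" for v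
    using frame u by (cases v) (auto simp: frame_def)
  then have "f \<in> ?F"
    using rat_gen_range_var rat_gen_least[of "range var"] by blast
  with f show "f \<in> rat_gen ?J"
    by (rule aff_scale_invariant_in_rat_gen[rotated])
      (use coframe_coeffs_invariant[OF assms] in blast)
qed

end
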